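(* Let $\mathcal A$ be a triangulated monoidal category and let $(\mathbf U_i,\eta_i)$ be unital idempotents in $\mathcal A$, fitting into distinguished triangles $$\mathbf C_i\xrightarrow{\varepsilon_i}\mathbb 1\xrightarrow{\eta_i}\mathbf U_i\xrightarrow{\delta_i}\mathbf C_i[1]$$ for $i=1,2$, with $(\mathbf C_i,\mathbf U_i)$ pairs of complementary idempotents. The following are equivalent: (1) $\mathbf U_1\otimes\mathbf U_2\cong\mathbf U_2$; (2) $\mathbf U_2\otimes\mathbf U_1\cong\mathbf U_2$; (3) there exists $\nu:\mathbf U_1\to\mathbf U_2$ such that $\nu\circ\eta_1=\eta_2$; (4) $\mathbf C_1\otimes\mathbf C_2\cong\mathbf C_1$; (5) $\mathbf C_2\otimes\mathbf C_1\cong\mathbf C_1$; (6) there exists $\theta:\mathbf C_1\to\mathbf C_2$ such that $\varepsilon_2\circ\theta=\varepsilon_1$. If any one of these equivalent conditions is satisfied, then the maps $\nu,\theta$ from (3) and (6) are unique, so that there is a unique map of triangles $(\theta,\mathrm{Id}_{\mathbb 1},\nu,\theta[1])$ from $\mathbf C_1\xrightarrow{\varepsilon_1}\mathbb 1\xrightarrow{\eta_1}\mathbf U_1\xrightarrow{\delta_1}\mathbf C_1[1]$ to $\mathbf C_2\xrightarrow{\varepsilon_2}\mathbb 1\xrightarrow{\eta_2}\mathbf U_2\xrightarrow{\delta_2}\mathbf C_2[1]$. Furthermore $\nu$ realizes $\mathbf U_2$ as a unital idempotent relative to $\mathbf U_1$, while $\theta$ realizes $\mathbf C_1$ as a counital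 idempotent relative to $\mathbf C_2$.
   Context: A triangulated monoidal category is an additive category $\mathcal A$ equipped with: a triangulated structure (an invertible suspension endofunctor $[1]$ and a class of distinguished triangles satisfying the usual axioms, including Verdier's octahedral axiom); a monoidal structure $(\otimes,\mathbb 1)$ with left unitor $\lambda$; and natural isomorphisms $\alpha_A:A\otimes\mathbb 1[1]\to A[1]$ and $\beta_A:\mathbb 1[1]\otimes A\to A\otimes\mathbb 1[1]$ such that (suppressing associators) $\alpha_{\mathbb 1}=\lambda_{\mathbb 1[1]}$, $\alpha_{A[1]}\circ(\alpha_A\otimes\mathrm{Id}_{\mathbb 1[1]})=\alpha_A[1]\circ\alpha_{A\otimes\mathbb 1[1]}$, $\beta_{\mathbb 1[1]}=-\mathrm{Id}$, and $\beta_{A\otimes B}=(\mathrm{Id}_A\otimes\beta_B)\circ(\beta_A\otimes\mathrm{Id}_B)$. Further, for each distinguished triangle $A\to B\to C\to A[1]$ and each object $D$, the triangles $D\otimes A\to D\otimes B\to D\otimes C\to (D\otimes A)[1]$ and $A\otimes D\to B\otimes D\to C\otimes D\to (A\otimes D)[1]$ are distinguished, where the identifications $D\otimes A[1]\cong(D\otimes A)[1]$ and $A[1]\otimes D\cong(A\otimes D)[1]$ are built from $\alpha,\beta$ and the associator. A pair of complementary idempotents in $\mathcal A$ is a pair of objects $(\mathbf C,\mathbf U)$ with $\mathbf C\otimes\mathbf U\cong 0\cong\mathbf U\otimes\mathbf C$, together with a distinguished triangle $\mathbf C\xrightarrow{\varepsilon}\mathbb 1\xrightarrow{\eta}\mathbf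 U\xrightarrow{\delta}\mathbf C[1]$. In this case $(\mathbf U,\eta)$ is called a unital idempotent and $(\mathbf C,\varepsilon)$ a counital idempotent. For an object $\mathbf E$ with $\mathbf E\otimes\mathbf E\cong\mathbf E$: a unital idempotent relative to $\mathbf E$ is an object $\mathbf U$ with a map $\nu:\mathbf E\to\mathbf U$ such that $\nu\otimes\mathrm{Id}_{\mathbf U}:\mathbf E\otimes\mathbf U\to\mathbf U\otimes\mathbf U$ and $\mathrm{Id}_{\mathbf U}\otimes\nu:\mathbf U\otimes\mathbf E\to\mathbf U\otimes\mathbf U$ are isomorphisms; a counital idempotent relative to $\mathbf E$ is an object $\mathbf C$ with a map $\theta:\mathbf C\to\mathbf E$ such that $\theta\otimes\mathrm{Id}_{\mathbf C}:\mathbf C\otimes\mathbf C\to\mathbf E\otimes\mathbf C$ and $\mathrm{Id}_{\mathbf C}\otimes\theta:\mathbf C\otimes\mathbf C\to\mathbf C\otimes\mathbf E$ are isomorphisms. *)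

theory Defs
  imports "HOL-Algebra.Group"
begin

section \<open>Categories\<close>

text \<open>
  Composition is written in the usual order: \<open>g \<cdot> f\<close> is \<open>g\<close> after \<open>f\<close>. The operations are total HOL
  functions; their values outside the objects, arrows and composable pairs are unconstrained.
\<close>

record ('o, 'm) cat =
  Obj :: "'o set"
  Arr :: "'m set"
  Dom :: "'m \<Rightarrow> 'o"
  Cod :: "'m \<Rightarrow> 'o"
  Idn :: "'o \<Rightarrow> 'm"
  Cmp :: "'m \<Rightarrow> 'm \<Rightarrow> 'm"  (infixr "\<cdot>\<index>" 55)

definition Hom :: "('o, 'm, 'z) cat_scheme \<Rightarrow> 'o \<Rightarrow> 'o \<Rightarrow> 'm set" where
  "Hom C A B = {f \<in> Arr C. Dom C f = A \<and> Cod C f = B}"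

locale category =
  fixes C :: "('o, 'm, 'z) cat_scheme" (structure)
  assumes dom_obj: "f \<in> Arr C \<Longrightarrow> Dom C f \<in> Obj C"
    and cod_obj: "f \<in> Arr C \<Longrightarrow> Cod C f \<in> Obj C"
    and idn_hom: "A \<in> Obj C \<Longrightarrow> Idn C A \<in> Hom C A A"
    and comp_hom: "f \<in> Hom C A B \<Longrightarrow> g \<in> Hom C B D \<Longrightarrow> g \<cdot> f \<in> Hom C A D"
    and comp_idn: "f \<in> Hom C A B \<Longrightarrow> f \<cdot> Idn C A = f"
    and idn_comp: "f \<in> Hom C A B \<Longrightarrow> Idn C B \<cdot> f = f"
    and comp_assoc: "f \<in> Hom C A B \<Longrightarrow> g \<in> Hom C B D \<Longrightarrow> h \<in> Hom C D E \<Longrightarrow>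
      (h \<cdot> g) \<cdot> f = h \<cdot> (g \<cdot> f)"

definition is_inverse :: "('o, 'm, 'z) cat_scheme \<Rightarrow> 'm \<Rightarrow> 'm \<Rightarrow> bool" where
  "is_inverse C f g \<longleftrightarrow> g \<in> Hom C (Cod C f) (Dom C f) \<and>
     g \<cdot>\<^bsub>C\<^esub> f = Idn C (Dom C f) \<and> f \<cdot>\<^bsub>C\<^esub> g = Idn C (Cod C f)"

definition iso_arr :: "('o, 'm, 'z) cat_scheme \<Rightarrow> 'm \<Rightarrow> bool" where
  "iso_arr C f \<longleftrightarrow> f \<in> Arr C \<and> (\<exists>g. is_inverse C f g)"

definition inv_arr :: "('o, 'm, 'z) cat_scheme \<Rightarrow> 'm \<Rightarrow> 'm" where
  "inv_arr C f = (THE g. is_inverse C f g)"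

definition isomorphic :: "('o, 'm, 'z) cat_scheme \<Rightarrow> 'o \<Rightarrow> 'o \<Rightarrow> bool"  (infix "\<simeq>\<index>" 50) where
  "A \<simeq>\<^bsub>C\<^esub> B \<longleftrightarrow> A \<in> Obj C \<and> B \<in> Obj C \<and> (\<exists>f \<in> Hom C A B. iso_arr C f)"

definition zero_object :: "('o, 'm, 'z) cat_scheme \<Rightarrow> 'o \<Rightarrow> bool" where
  "zero_object C Z \<longleftrightarrow> Z \<in> Obj C \<and>
     (\<forall>A \<in> Obj C. (\<exists>!f. f \<in> Hom C A Z) \<and> (\<exists>!f. f \<in> Hom C Z A))"


section \<open>Additive categories\<close>

record ('o, 'm) additive_cat = "('o, 'm) cat" +
  Add :: "'m \<Rightarrow> 'm \<Rightarrow> 'm"  (infixl "\<boxplus>\<index>" 53)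
  Zero :: "'o \<Rightarrow> 'o \<Rightarrow> 'm"

definition hom_group :: "('o, 'm, 'z) additive_cat_scheme \<Rightarrow> 'o \<Rightarrow> 'o \<Rightarrow> 'm monoid" where
  "hom_group C A B = \<lparr>carrier = Hom C A B, monoid.mult = Add C, monoid.one = Zero C A B\<rparr>"

definition Neg :: "('o, 'm, 'z) additive_cat_scheme \<Rightarrow> 'm \<Rightarrow> 'm" where
  "Neg C f = inv\<^bsub>hom_group C (Dom C f) (Cod C f)\<^esub> f"

definition biproduct ::
  "('o, 'm, 'z) additive_cat_scheme \<Rightarrow> 'o \<Rightarrow> 'o \<Rightarrow> 'o \<Rightarrow> 'm \<Rightarrow> 'm \<Rightarrow> 'm \<Rightarrow> 'm \<Rightarrow> bool" where
  "biproduct C A B P i j p q \<longleftrightarrow>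
     i \<in> Hom C A P \<and> j \<in> Hom C B P \<and> p \<in> Hom C P A \<and> q \<in> Hom C P B \<and>
     p \<cdot>\<^bsub>C\<^esub> i = Idn C A \<and> q \<cdot>\<^bsub>C\<^esub> j = Idn C B \<and>
     p \<cdot>\<^bsub>C\<^esub> j = Zero C B A \<and> q \<cdot>\<^bsub>C\<^esub> i = Zero C A B \<and>
     (i \<cdot>\<^bsub>C\<^esub> p) \<boxplus>\<^bsub>C\<^esub> (j \<cdot>\<^bsub>C\<^esub> q) = Idn C P"

locale additive_category = category C
  for C :: "('o, 'm, 'z) additive_cat_scheme" (structure) +
  assumes hom_group: "A \<in> Obj C \<Longrightarrow> B \<in> Obj C \<Longrightarrow> comm_group (hom_group C A B)"
    and comp_add: "f \<in> Hom C A B \<Longrightarrow> f' \<in> Hom C A B \<Longrightarrow> g \<in> Hom C B D \<Longrightarrow>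
      g \<cdot> (f \<boxplus> f') = (g \<cdot> f) \<boxplus> (g \<cdot> f')"
    and add_comp: "f \<in> Hom C A B \<Longrightarrow> g \<in> Hom C B D \<Longrightarrow> g' \<in> Hom C B D \<Longrightarrow>
      (g \<boxplus> g') \<cdot> f = (g \<cdot> f) \<boxplus> (g' \<cdot> f)"
    and zero_object_ex: "\<exists>Z. zero_object C Z"
    and biproduct_ex: "A \<in> Obj C \<Longrightarrow> B \<in> Obj C \<Longrightarrow> \<exists>P i j p q. biproduct C A B P i j p q"


section \<open>Triangulated categories\<close>

text \<open>
  A triangle \<open>A \<rightarrow> B \<rightarrow> D \<rightarrow> A[1]\<close> is represented by its three arrows, which determine the objects.
\<close>

record ('o, 'm) triangulated_cat = "('o, 'm) additive_cat" +
  ShiftO :: "'o \<Rightarrow> 'o"  ("_[1]\<^sub>o\<index>" [999] 999)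
  ShiftM :: "'m \<Rightarrow> 'm"  ("_[1]\<^sub>m\<index>" [999] 999)
  Tri :: "('m \<times> 'm \<times> 'm) set"

fun triangle :: "('o, 'm, 'z) triangulated_cat_scheme \<Rightarrow> 'm \<times> 'm \<times> 'm \<Rightarrow> bool" where
  "triangle C (f, g, h) \<longleftrightarrow> f \<in> Arr C \<and> g \<in> Arr C \<and> h \<in> Arr C \<and>
     Dom C g = Cod C f \<and> Dom C h = Cod C g \<and> Cod C h = (Dom C f)[1]\<^sub>o\<^bsub>C\<^esub>"

text \<open>
  In a map of triangles \<open>(a, b, c, a[1])\<close> the fourth component is left implicit.
\<close>

fun triangle_map :: "('o, 'm, 'z) triangulated_cat_scheme \<Rightarrow>
    'm \<times> 'm \<times> 'm \<Rightarrow> 'm \<times> 'm \<times> 'm \<Rightarrow> 'm \<times> 'm \<times> 'm \<Rightarrow> bool" where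
  "triangle_map C (f, g, h) (f', g', h') (a, b, c) \<longleftrightarrow>
     a \<in> Hom C (Dom C f) (Dom C f') \<and>
     b \<in> Hom C (Dom C g) (Dom C g') \<and>
     c \<in> Hom C (Dom C h) (Dom C h') \<and>
     b \<cdot>\<^bsub>C\<^esub> f = f' \<cdot>\<^bsub>C\<^esub> a \<and>
     c \<cdot>\<^bsub>C\<^esub> g = g' \<cdot>\<^bsub>C\<^esub> b \<and>
     a[1]\<^sub>m\<^bsub>C\<^esub> \<cdot>\<^bsub>C\<^esub> h = h' \<cdot>\<^bsub>C\<^esub> c"

text \<open>
  The suspension is an automorphism of the category: a functor bijective on objects and on arrows.
\<close>

locale triangulated_category = additive_category C
  for C :: "('o, 'm, 'z) triangulated_cat_scheme" (structure) +
  assumes shift_obj_bij: "bij_betw (ShiftO C) (Obj C) (Obj C)"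
    and shift_arr_bij: "bij_betw (ShiftM C) (Arr C) (Arr C)"
    and shift_hom: "f \<in> Hom C A B \<Longrightarrow> f[1]\<^sub>m \<in> Hom C (A[1]\<^sub>o) (B[1]\<^sub>o)"
    and shift_idn: "A \<in> Obj C \<Longrightarrow> (Idn C A)[1]\<^sub>m = Idn C (A[1]\<^sub>o)"
    and shift_comp: "f \<in> Hom C A B \<Longrightarrow> g \<in> Hom C B D \<Longrightarrow> (g \<cdot> f)[1]\<^sub>m = g[1]\<^sub>m \<cdot> f[1]\<^sub>m"
    and shift_add: "f \<in> Hom C A B \<Longrightarrow> f' \<in> Hom C A B \<Longrightarrow> (f \<boxplus> f')[1]\<^sub>m = f[1]\<^sub>m \<boxplus> f'[1]\<^sub>m"
    and tri_triangle: "t \<in> Tri C \<Longrightarrow> triangle C t"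
    and tri_iso: "t \<in> Tri C \<Longrightarrow> triangle C t' \<Longrightarrow> triangle_map C t t' (a, b, c) \<Longrightarrow>
      iso_arr C a \<Longrightarrow> iso_arr C b \<Longrightarrow> iso_arr C c \<Longrightarrow> t' \<in> Tri C"
    and tri_idn: "A \<in> Obj C \<Longrightarrow> zero_object C Z \<Longrightarrow>
      (Idn C A, Zero C A Z, Zero C Z (A[1]\<^sub>o)) \<in> Tri C"
    and tri_cone: "f \<in> Arr C \<Longrightarrow> \<exists>g h. (f, g, h) \<in> Tri C"
    and tri_rotate: "triangle C (f, g, h) \<Longrightarrow>
      (f, g, h) \<in> Tri C \<longleftrightarrow> (g, h, Neg C (f[1]\<^sub>m)) \<in> Tri C"
    and tri_fill: "(f, g, h) \<in> Tri C \<Longrightarrow> (f', g', h') \<in> Tri C \<Longrightarrow>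
      a \<in> Hom C (Dom C f) (Dom C f') \<Longrightarrow> b \<in> Hom C (Cod C f) (Cod C f') \<Longrightarrow>
      b \<cdot> f = f' \<cdot> a \<Longrightarrow> \<exists>c. triangle_map C (f, g, h) (f', g', h') (a, b, c)"
    and tri_octahedral: "f \<in> Hom C X Y \<Longrightarrow> g \<in> Hom C Y Z \<Longrightarrow>
      (f, f', f'') \<in> Tri C \<Longrightarrow> (g, g', g'') \<in> Tri C \<Longrightarrow> (g \<cdot> f, h', h'') \<in> Tri C \<Longrightarrow>
      \<exists>u v. (u, v, f'[1]\<^sub>m \<cdot> g'') \<in> Tri C \<and>
        u \<cdot> f' = h' \<cdot> g \<and> h'' \<cdot> u = f'' \<and> v \<cdot> h' = g' \<and> g'' \<cdot> v = f[1]\<^sub>m \<cdot> h''"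


section \<open>Triangulated monoidal categories\<close>

text \<open>
  The structure isomorphisms are
  \<open>Asc A B D : (A \<otimes> B) \<otimes> D \<rightarrow> A \<otimes> (B \<otimes> D)\<close>, \<open>Lun A : \<one> \<otimes> A \<rightarrow> A\<close>, \<open>Run A : A \<otimes> \<one> \<rightarrow> A\<close>,
  \<open>Alp A : A \<otimes> \<one>[1] \<rightarrow> A[1]\<close> and \<open>Bet A : \<one>[1] \<otimes> A \<rightarrow> A \<otimes> \<one>[1]\<close>.
\<close>

record ('o, 'm) tmcat = "('o, 'm) triangulated_cat" +
  TensO :: "'o \<Rightarrow> 'o \<Rightarrow> 'o"  (infixl "\<otimes>\<^sub>o\<index>" 70)
  TensM :: "'m \<Rightarrow> 'm \<Rightarrow> 'm"  (infixl "\<otimes>\<^sub>m\<index>" 70)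
  Unt :: 'o
  Asc :: "'o \<Rightarrow> 'o \<Rightarrow> 'o \<Rightarrow> 'm"
  Lun :: "'o \<Rightarrow> 'm"
  Run :: "'o \<Rightarrow> 'm"
  Alp :: "'o \<Rightarrow> 'm"
  Bet :: "'o \<Rightarrow> 'm"

locale monoidal_category = category C
  for C :: "('o, 'm, 'z) tmcat_scheme" (structure) +
  assumes unt_obj: "Unt C \<in> Obj C"
    and tens_obj: "A \<in> Obj C \<Longrightarrow> B \<in> Obj C \<Longrightarrow> A \<otimes>\<^sub>o B \<in> Obj C"
    and tens_hom: "f \<in> Hom C A A' \<Longrightarrow> g \<in> Hom C B B' \<Longrightarrow> f \<otimes>\<^sub>m g \<in> Hom C (A \<otimes>\<^sub>o B) (A' \<otimes>\<^sub>o B')"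
    and tens_idn: "A \<in> Obj C \<Longrightarrow> B \<in> Obj C \<Longrightarrow> Idn C A \<otimes>\<^sub>m Idn C B = Idn C (A \<otimes>\<^sub>o B)"
    and tens_comp: "f \<in> Hom C A A' \<Longrightarrow> f' \<in> Hom C A' A'' \<Longrightarrow> g \<in> Hom C B B' \<Longrightarrow> g' \<in> Hom C B' B'' \<Longrightarrow>
      (f' \<cdot> f) \<otimes>\<^sub>m (g' \<cdot> g) = (f' \<otimes>\<^sub>m g') \<cdot> (f \<otimes>\<^sub>m g)"
    and asc_hom: "A \<in> Obj C \<Longrightarrow> B \<in> Obj C \<Longrightarrow> D \<in> Obj C \<Longrightarrow>
      Asc C A B D \<in> Hom C ((A \<otimes>\<^sub>o B) \<otimes>\<^sub>o D) (A \<otimes>\<^sub>o (B \<otimes>\<^sub>o D))"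
    and asc_iso: "A \<in> Obj C \<Longrightarrow> B \<in> Obj C \<Longrightarrow> D \<in> Obj C \<Longrightarrow> iso_arr C (Asc C A B D)"
    and asc_nat: "f \<in> Hom C A A' \<Longrightarrow> g \<in> Hom C B B' \<Longrightarrow> h \<in> Hom C D D' \<Longrightarrow>
      Asc C A' B' D' \<cdot> ((f \<otimes>\<^sub>m g) \<otimes>\<^sub>m h) = (f \<otimes>\<^sub>m (g \<otimes>\<^sub>m h)) \<cdot> Asc C A B D"
    and lun_hom: "A \<in> Obj C \<Longrightarrow> Lun C A \<in> Hom C (Unt C \<otimes>\<^sub>o A) A"
    and lun_iso: "A \<in> Obj C \<Longrightarrow> iso_arr C (Lun C A)"
    and lun_nat: "f \<in> Hom C A A' \<Longrightarrow> Lun C A' \<cdot> (Idn C (Unt C) \<otimes>\<^sub>m f) = f \<cdot> Lun C A"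
    and run_hom: "A \<in> Obj C \<Longrightarrow> Run C A \<in> Hom C (A \<otimes>\<^sub>o Unt C) A"
    and run_iso: "A \<in> Obj C \<Longrightarrow> iso_arr C (Run C A)"
    and run_nat: "f \<in> Hom C A A' \<Longrightarrow> Run C A' \<cdot> (f \<otimes>\<^sub>m Idn C (Unt C)) = f \<cdot> Run C A"
    and pentagon: "A \<in> Obj C \<Longrightarrow> B \<in> Obj C \<Longrightarrow> D \<in> Obj C \<Longrightarrow> E \<in> Obj C \<Longrightarrow>
      Asc C A B (D \<otimes>\<^sub>o E) \<cdot> Asc C (A \<otimes>\<^sub>o B) D E =
      (Idn C A \<otimes>\<^sub>m Asc C B D E) \<cdot> Asc C A (B \<otimes>\<^sub>o D) E \<cdot> (Asc C A B D \<otimes>\<^sub>m Idn C E)"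
    and unit_triangle: "A \<in> Obj C \<Longrightarrow> B \<in> Obj C \<Longrightarrow>
      (Idn C A \<otimes>\<^sub>m Lun C B) \<cdot> Asc C A (Unt C) B = Run C A \<otimes>\<^sub>m Idn C B"

text \<open>
  The identifications \<open>D \<otimes> A[1] \<rightarrow> (D \<otimes> A)[1]\<close> and \<open>A[1] \<otimes> D \<rightarrow> (A \<otimes> D)[1]\<close>, the latter moving
  \<open>\<one>[1]\<close> past \<open>D\<close> by \<open>Bet D\<close>.
\<close>

definition shift_left :: "('o, 'm, 'z) tmcat_scheme \<Rightarrow> 'o \<Rightarrow> 'o \<Rightarrow> 'm" where
  "shift_left C D A =
     Alp C (D \<otimes>\<^sub>o\<^bsub>C\<^esub> A) \<cdot>\<^bsub>C\<^esub>
     inv_arr C (Asc C D A ((Unt C)[1]\<^sub>o\<^bsub>C\<^esub>)) \<cdot>\<^bsub>C\<^esub>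
     (Idn C D \<otimes>\<^sub>m\<^bsub>C\<^esub> inv_arr C (Alp C A))"

definition shift_right :: "('o, 'm, 'z) tmcat_scheme \<Rightarrow> 'o \<Rightarrow> 'o \<Rightarrow> 'm" where
  "shift_right C A D =
     Alp C (A \<otimes>\<^sub>o\<^bsub>C\<^esub> D) \<cdot>\<^bsub>C\<^esub>
     inv_arr C (Asc C A D ((Unt C)[1]\<^sub>o\<^bsub>C\<^esub>)) \<cdot>\<^bsub>C\<^esub>
     (Idn C A \<otimes>\<^sub>m\<^bsub>C\<^esub> Bet C D) \<cdot>\<^bsub>C\<^esub>
     Asc C A ((Unt C)[1]\<^sub>o\<^bsub>C\<^esub>) D \<cdot>\<^bsub>C\<^esub>
     (inv_arr C (Alp C A) \<otimes>\<^sub>m\<^bsub>C\<^esub> Idn C D)"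

text \<open>
  Biadditivity of the tensor product is not assumed separately; it follows from the preservation of
  distinguished triangles.
\<close>

locale triangulated_monoidal_category = triangulated_category C + monoidal_category C
  for C :: "('o, 'm, 'z) tmcat_scheme" (structure) +
  assumes alp_hom: "A \<in> Obj C \<Longrightarrow> Alp C A \<in> Hom C (A \<otimes>\<^sub>o (Unt C)[1]\<^sub>o) (A[1]\<^sub>o)"
    and alp_iso: "A \<in> Obj C \<Longrightarrow> iso_arr C (Alp C A)"
    and alp_nat: "f \<in> Hom C A A' \<Longrightarrow>
      Alp C A' \<cdot> (f \<otimes>\<^sub>m Idn C ((Unt C)[1]\<^sub>o)) = f[1]\<^sub>m \<cdot> Alp C A"
    and bet_hom: "A \<in> Obj C \<Longrightarrow> Bet C A \<in> Hom C ((Unt C)[1]\<^sub>o \<otimes>\<^sub>o A) (A \<otimes>\<^sub>o (Unt C)[1]\<^sub>o)"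
    and bet_iso: "A \<in> Obj C \<Longrightarrow> iso_arr C (Bet C A)"
    and bet_nat: "f \<in> Hom C A A' \<Longrightarrow>
      Bet C A' \<cdot> (Idn C ((Unt C)[1]\<^sub>o) \<otimes>\<^sub>m f) = (f \<otimes>\<^sub>m Idn C ((Unt C)[1]\<^sub>o)) \<cdot> Bet C A"
    and alp_unt: "Alp C (Unt C) = Lun C ((Unt C)[1]\<^sub>o)"
    and alp_shift: "A \<in> Obj C \<Longrightarrow>
      Alp C (A[1]\<^sub>o) \<cdot> (Alp C A \<otimes>\<^sub>m Idn C ((Unt C)[1]\<^sub>o)) =
      (Alp C A)[1]\<^sub>m \<cdot> Alp C (A \<otimes>\<^sub>o (Unt C)[1]\<^sub>o)"
    and bet_unt: "Bet C ((Unt C)[1]\<^sub>o) = Neg C (Idn C ((Unt C)[1]\<^sub>o \<otimes>\<^sub>o (Unt C)[1]\<^sub>o))"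
    and bet_tens: "A \<in> Obj C \<Longrightarrow> B \<in> Obj C \<Longrightarrow>
      Bet C (A \<otimes>\<^sub>o B) =
      inv_arr C (Asc C A B ((Unt C)[1]\<^sub>o)) \<cdot> (Idn C A \<otimes>\<^sub>m Bet C B) \<cdot>
      Asc C A ((Unt C)[1]\<^sub>o) B \<cdot> (Bet C A \<otimes>\<^sub>m Idn C B) \<cdot>
      inv_arr C (Asc C ((Unt C)[1]\<^sub>o) A B)"
    and tri_tens_left: "(f, g, h) \<in> Tri C \<Longrightarrow> D \<in> Obj C \<Longrightarrow>
      (Idn C D \<otimes>\<^sub>m f, Idn C D \<otimes>\<^sub>m g, shift_left C D (Dom C f) \<cdot> (Idn C D \<otimes>\<^sub>m h)) \<in> Tri C"
    and tri_tens_right: "(f, g, h) \<in> Tri C \<Longrightarrow> D \<in> Obj C \<Longrightarrow>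
      (f \<otimes>\<^sub>m Idn C D, g \<otimes>\<^sub>m Idn C D, shift_right C (Dom C f) D \<cdot> (h \<otimes>\<^sub>m Idn C D)) \<in> Tri C"


section \<open>Idempotents\<close>

definition complementary_idempotents ::
  "('o, 'm, 'z) tmcat_scheme \<Rightarrow> 'o \<Rightarrow> 'o \<Rightarrow> 'm \<Rightarrow> 'm \<Rightarrow> 'm \<Rightarrow> bool" where
  "complementary_idempotents T C U \<epsilon> \<eta> \<delta> \<longleftrightarrow>
     C \<in> Obj T \<and> U \<in> Obj T \<and>
     (\<exists>Z. zero_object T Z \<and> C \<otimes>\<^sub>o\<^bsub>T\<^esub> U \<simeq>\<^bsub>T\<^esub> Z \<and> U \<otimes>\<^sub>o\<^bsub>T\<^esub> C \<simeq>\<^bsub>T\<^esub> Z) \<and>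
     \<epsilon> \<in> Hom T C (Unt T) \<and> \<eta> \<in> Hom T (Unt T) U \<and> \<delta> \<in> Hom T U (C[1]\<^sub>o\<^bsub>T\<^esub>) \<and>
     (\<epsilon>, \<eta>, \<delta>) \<in> Tri T"

definition unital_idempotent_rel ::
  "('o, 'm, 'z) tmcat_scheme \<Rightarrow> 'o \<Rightarrow> 'o \<Rightarrow> 'm \<Rightarrow> bool" where
  "unital_idempotent_rel T E U \<nu> \<longleftrightarrow>
     E \<in> Obj T \<and> E \<otimes>\<^sub>o\<^bsub>T\<^esub> E \<simeq>\<^bsub>T\<^esub> E \<and> U \<in> Obj T \<and> \<nu> \<in> Hom T E U \<and>
     iso_arr T (\<nu> \<otimes>\<^sub>m\<^bsub>T\<^esub> Idn T U) \<and> iso_arr T (Idn T U \<otimes>\<^sub>m\<^bsub>T\<^esub> \<nu>)"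

definition counital_idempotent_rel ::
  "('o, 'm, 'z) tmcat_scheme \<Rightarrow> 'o \<Rightarrow> 'o \<Rightarrow> 'm \<Rightarrow> bool" where
  "counital_idempotent_rel T E C \<theta> \<longleftrightarrow>
     E \<in> Obj T \<and> E \<otimes>\<^sub>o\<^bsub>T\<^esub> E \<simeq>\<^bsub>T\<^esub> E \<and> C \<in> Obj T \<and> \<theta> \<in> Hom T C E \<and>
     iso_arr T (\<theta> \<otimes>\<^sub>m\<^bsub>T\<^esub> Idn T C) \<and> iso_arr T (Idn T C \<otimes>\<^sub>m\<^bsub>T\<^esub> \<theta>)"

end

theory Submission
  imports Defs
begin

text \<open>
  Tensoring the triangle \<open>C\<^sub>i \<rightarrow> \<one> \<rightarrow> U\<^sub>i\<close> with an object \<open>X\<close> shows that \<open>\<eta>\<^sub>i \<otimes> X\<close> is invertible as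
  soon as \<open>C\<^sub>i \<otimes> X = 0\<close>, and \<open>\<epsilon>\<^sub>i \<otimes> X\<close> as soon as \<open>U\<^sub>i \<otimes> X = 0\<close>. Hence conditions (1) and (4)
  both say \<open>C\<^sub>1 \<otimes> U\<^sub>2 = 0\<close>, while (2) and (5) say \<open>U\<^sub>2 \<otimes> C\<^sub>1 = 0\<close>. By exactness (3) and (6) both say
  \<open>\<eta>\<^sub>2 \<epsilon>\<^sub>1 = 0\<close>. This follows from either vanishing because \<open>f : A \<rightarrow> B\<close> is zero whenever
  \<open>U\<^sub>1 \<otimes> A = 0 = C\<^sub>1 \<otimes> B\<close>. Conversely, if \<open>\<eta>\<^sub>2 \<epsilon>\<^sub>1 = 0\<close> then \<open>\<epsilon>\<^sub>1 \<otimes> U\<^sub>2 = 0\<close>, since \<open>\<eta>\<^sub>2 \<otimes> U\<^sub>2\<close> is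
  invertible; but \<open>C\<^sub>1 \<otimes> \<epsilon>\<^sub>1 \<otimes> U\<^sub>2\<close> is invertible as well, so \<open>C\<^sub>1 \<otimes> U\<^sub>2 = 0\<close>. Uniqueness of \<open>\<nu>\<close> holds
  because \<open>\<nu>\<close> is determined by \<open>U\<^sub>1 \<otimes> \<nu>\<close>, which is determined by \<open>U\<^sub>1 \<otimes> (\<nu> \<eta>\<^sub>1)\<close>; dually for \<open>\<theta>\<close>.
\<close>

section \<open>Isomorphisms\<close>

context category
begin

lemma hom_obj: "f \<in> Hom C A B \<Longrightarrow> A \<in> Obj C" "f \<in> Hom C A B \<Longrightarrow> B \<in> Obj C"
  using dom_obj cod_obj by (auto simp: Hom_def)

text \<open>A left inverse g and a right inverse h coincide, since g = g f h = h. Stated with two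
  arrows because exactness of a triangle produces the two one-sided inverses separately.\<close>

lemma iso_arrI:
  assumes f: "f \<in> Hom C A B" and g: "g \<in> Hom C B A" and h: "h \<in> Hom C B A"
    and gf: "g \<cdot> f = Idn C A" and fh: "f \<cdot> h = Idn C B"
  shows "iso_arr C f"
proof -
  have "g = (g \<cdot> f) \<cdot> h"
    using comp_assoc[OF h f g] comp_idn[OF g] fh by simp
  then have "g = h"
    using idn_comp[OF h] gf by simp
  then show ?thesis
    using assms by (auto simp: iso_arr_def is_inverse_def Hom_def)
qed

lemma iso_arrE:
  assumes "iso_arr C f" and "f \<in> Hom C A B"
  obtains g where "g \<in> Hom C B A" "g \<cdot> f = Idn C A" "f \<cdot> g = Idn C B" "iso_arr C g"
proof -
  from assms obtain g where g: "g \<in> Hom C B A" "g \<cdot> f = Idn C A" "f \<cdot> g = Idn C B"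
    by (auto simp: iso_arr_def is_inverse_def Hom_def)
  with iso_arrI[OF g(1) assms(2) assms(2)] show thesis
    using that by blast
qed

lemma iso_comp:
  assumes f: "f \<in> Hom C A B" "iso_arr C f" and g: "g \<in> Hom C B D" "iso_arr C g"
  shows "iso_arr C (g \<cdot> f)"
proof -
  obtain f' where f': "f' \<in> Hom C B A" "f' \<cdot> f = Idn C A" "f \<cdot> f' = Idn C B"
    using iso_arrE[OF f(2,1)] by blast
  obtain g' where g': "g' \<in> Hom C D B" "g' \<cdot> g = Idn C B" "g \<cdot> g' = Idn C D"
    using iso_arrE[OF g(2,1)] by blast
  have gf: "g \<cdot> f \<in> Hom C A D" and fg: "f' \<cdot> g' \<in> Hom C D A"
    using f g f' g' comp_hom by blast+
  have "(f' \<cdot> g') \<cdot> (g \<cdot> f) = f' \<cdot> ((g' \<cdot> g) \<cdot> f)"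
    using comp_assoc[OF gf g'(1) f'(1)] comp_assoc[OF f(1) g(1) g'(1)] by simp
  also have "\<dots> = Idn C A"
    using f' g'(2) idn_comp[OF f(1)] by simp
  finally have 1: "(f' \<cdot> g') \<cdot> (g \<cdot> f) = Idn C A" .
  have "(g \<cdot> f) \<cdot> (f' \<cdot> g') = g \<cdot> ((f \<cdot> f') \<cdot> g')"
    using comp_assoc[OF fg f(1) g(1)] comp_assoc[OF g'(1) f'(1) f(1)] by simp
  also have "\<dots> = Idn C D"
    using g' f'(3) idn_comp[OF g'(1)] by simp
  finally show ?thesis
    using iso_arrI[OF gf fg fg 1] by blast
qed

lemma iso_mono:
  assumes f: "f \<in> Hom C A B" and f': "f' \<in> Hom C A B"
    and g: "g \<in> Hom C B D" "iso_arr C g" and eq: "g \<cdot> f = g \<cdot> f'"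
  shows "f = f'"
proof -
  obtain k where k: "k \<in> Hom C D B" "k \<cdot> g = Idn C B"
    using iso_arrE[OF g(2,1)] by blast
  have "f = k \<cdot> (g \<cdot> f)"
    using comp_assoc[OF f g(1) k(1)] k(2) idn_comp[OF f] by simp
  also have "\<dots> = f'"
    using comp_assoc[OF f' g(1) k(1)] k(2) idn_comp[OF f'] eq by simp
  finally show ?thesis .
qed

lemma iso_epi:
  assumes f: "f \<in> Hom C B D" and f': "f' \<in> Hom C B D"
    and g: "g \<in> Hom C A B" "iso_arr C g" and eq: "f \<cdot> g = f' \<cdot> g"
  shows "f = f'"
proof -
  obtain k where k: "k \<in> Hom C B A" "g \<cdot> k = Idn C B"
    using iso_arrE[OF g(2,1)] by blast
  have "f = (f \<cdot> g) \<cdot> k"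
    using comp_assoc[OF k(1) g(1) f] k(2) comp_idn[OF f] by simp
  also have "\<dots> = f'"
    using comp_assoc[OF k(1) g(1) f'] k(2) comp_idn[OF f'] eq by simp
  finally show ?thesis .
qed

lemma iso_cancel_right:
  assumes f: "f \<in> Hom C A B" "iso_arr C f" and g: "g \<in> Hom C B D"
    and gf: "iso_arr C (g \<cdot> f)"
  shows "iso_arr C g"
proof -
  obtain k where k: "k \<in> Hom C B A" "f \<cdot> k = Idn C B" "iso_arr C k"
    using iso_arrE[OF f(2,1)] by blast
  have "g = (g \<cdot> f) \<cdot> k"
    using comp_assoc[OF k(1) f(1) g] k(2) comp_idn[OF g] by simp
  then show ?thesis
    using iso_comp[OF k(1,3) comp_hom[OF f(1) g] gf] by simp
qed

lemma iso_cancel_left: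
  assumes f: "f \<in> Hom C A B" and g: "g \<in> Hom C B D" "iso_arr C g"
    and gf: "iso_arr C (g \<cdot> f)"
  shows "iso_arr C f"
proof -
  obtain k where k: "k \<in> Hom C D B" "k \<cdot> g = Idn C B" "iso_arr C k"
    using iso_arrE[OF g(2,1)] by blast
  have "f = k \<cdot> (g \<cdot> f)"
    using comp_assoc[OF f g(1) k(1)] k(2) idn_comp[OF f] by simp
  then show ?thesis
    using iso_comp[OF comp_hom[OF f g(1)] gf k(1,3)] by simp
qed

lemma isomorphicI: "f \<in> Hom C A B \<Longrightarrow> iso_arr C f \<Longrightarrow> A \<simeq> B"
  using hom_obj by (auto simp: isomorphic_def)

lemma isomorphic_sym: "A \<simeq> B \<Longrightarrow> B \<simeq> A"
  unfolding isomorphic_def by (meson iso_arrE)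

lemma isomorphic_trans: "A \<simeq> B \<Longrightarrow> B \<simeq> D \<Longrightarrow> A \<simeq> D"
  unfolding isomorphic_def by (meson comp_hom iso_comp)

lemma to_zero_unique:
  "zero_object C Z \<Longrightarrow> f \<in> Hom C A Z \<Longrightarrow> g \<in> Hom C A Z \<Longrightarrow> f = g"
  using hom_obj(1) unfolding zero_object_def by blast

lemma from_zero_unique:
  "zero_object C Z \<Longrightarrow> f \<in> Hom C Z A \<Longrightarrow> g \<in> Hom C Z A \<Longrightarrow> f = g"
  using hom_obj(2) unfolding zero_object_def by blast

end


section \<open>Zero arrows\<close>

context additive_category
begin

lemma zero_hom: "A \<in> Obj C \<Longrightarrow> B \<in> Obj C \<Longrightarrow> Zero C A B \<in> Hom C A B"
  using comm_group.axioms(1)[OF hom_group, THEN comm_monoid.axioms(1), THEN monoid.one_closed]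
  by (simp add: hom_group_def)

text \<open>Cancellation in the Hom group. Composition on either side and the suspension send 0 = 0
  + 0 to an arrow of this kind, which is how they are seen to preserve zero.\<close>

lemma add_self_zero:
  assumes f: "f \<in> Hom C A B" and eq: "f \<boxplus> f = f"
  shows "f = Zero C A B"
proof -
  interpret G: comm_group "hom_group C A B"
    using hom_group hom_obj[OF f] by blast
  show ?thesis
    using G.r_cancel_one[of f f] f eq by (simp add: hom_group_def)
qed

lemma zero_add_zero:
  assumes "A \<in> Obj C" "B \<in> Obj C"
  shows "Zero C A B \<boxplus> Zero C A B = Zero C A B"
proof -
  interpret G: comm_group "hom_group C A B"
    using hom_group assms by blast
  show ?thesis
    using G.r_one[OF G.one_closed] by (simp add: hom_group_def)
qed

lemma comp_zero:
  assumes A: "A \<in> Obj C" and g: "g \<in> Hom C B D"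
  shows "g \<cdot> Zero C A B = Zero C A D"
proof -
  have z: "Zero C A B \<in> Hom C A B"
    using zero_hom A hom_obj[OF g] by blast
  show ?thesis
    using add_self_zero[OF comp_hom[OF z g]] comp_add[OF z z g]
      zero_add_zero[OF A hom_obj(1)[OF g]] by simp
qed

lemma zero_comp:
  assumes f: "f \<in> Hom C A B" and D: "D \<in> Obj C"
  shows "Zero C B D \<cdot> f = Zero C A D"
proof -
  have z: "Zero C B D \<in> Hom C B D"
    using zero_hom D hom_obj[OF f] by blast
  show ?thesis
    using add_self_zero[OF comp_hom[OF f z]] add_comp[OF f z z]
      zero_add_zero[OF hom_obj(2)[OF f] D] by simp
qed

lemma to_zero_eq: "zero_object C Z \<Longrightarrow> f \<in> Hom C A Z \<Longrightarrow> f = Zero C A Z"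
  using to_zero_unique zero_hom hom_obj by blast

lemma from_zero_eq: "zero_object C Z \<Longrightarrow> f \<in> Hom C Z A \<Longrightarrow> f = Zero C Z A"
  using from_zero_unique zero_hom hom_obj by blast

lemma factor_zero:
  "zero_object C Z \<Longrightarrow> f \<in> Hom C A Z \<Longrightarrow> g \<in> Hom C Z B \<Longrightarrow> g \<cdot> f = Zero C A B"
  using to_zero_eq comp_zero hom_obj(1) by metis

text \<open>Any arrow into or out of A is its composite with the identity of A, hence zero.\<close>

lemma zero_objectI:
  assumes A: "A \<in> Obj C" and eq: "Idn C A = Zero C A A"
  shows "zero_object C A"
  unfolding zero_object_def
proof (intro conjI ballI)
  fix B assume B: "B \<in> Obj C"
  have "f = Zero C B A" if "f \<in> Hom C B A" for f
    using idn_comp[OF that] zero_comp[OF that A] eq by simp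
  then show "\<exists>!f. f \<in> Hom C B A"
    using zero_hom[OF B A] by blast
  have "f = Zero C A B" if "f \<in> Hom C A B" for f
    using comp_idn[OF that] comp_zero[OF A that] eq by simp
  then show "\<exists>!f. f \<in> Hom C A B"
    using zero_hom[OF A B] by blast
qed (rule A)

lemma zero_object_isomorphic:
  assumes "A \<simeq> Z" and "zero_object C Z"
  shows "zero_object C A"
proof -
  obtain f where f: "f \<in> Hom C A Z" "iso_arr C f"
    using assms(1) by (auto simp: isomorphic_def)
  obtain g where "g \<in> Hom C Z A" "g \<cdot> f = Idn C A"
    using iso_arrE[OF f(2,1)] by blast
  then show ?thesis
    using factor_zero[OF assms(2) f(1)] hom_obj(1)[OF f(1)] zero_objectI by metis
qed

text \<open>The identity of B factors through the zero arrow, so it is zero itself.\<close>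

lemma zero_iso_zero_object:
  assumes A: "A \<in> Obj C" "B \<in> Obj C" and iso: "iso_arr C (Zero C A B)"
  shows "zero_object C B"
proof -
  obtain g where "g \<in> Hom C B A" "Zero C A B \<cdot> g = Idn C B"
    using iso_arrE[OF iso zero_hom[OF A]] by blast
  then show ?thesis
    using zero_comp[of g B A B] A(2) zero_objectI by metis
qed

section \<open>Negation of arrows, for the signs in rotated triangles\<close>

lemma neg_hom:
  assumes f: "f \<in> Hom C A B"
  shows "Neg C f \<in> Hom C A B"
proof -
  interpret G: comm_group "hom_group C A B"
    using hom_group hom_obj[OF f] by blast
  show ?thesis
    using G.inv_closed[of f] f by (simp add: Neg_def Hom_def hom_group_def)
qed

lemma add_neg:
  assumes f: "f \<in> Hom C A B"
  shows "f \<boxplus> Neg C f = Zero C A B"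
proof -
  interpret G: comm_group "hom_group C A B"
    using hom_group hom_obj[OF f] by blast
  show ?thesis
    using G.r_inv[of f] f by (simp add: Neg_def Hom_def hom_group_def)
qed

lemma neg_unique:
  assumes f: "f \<in> Hom C A B" and g: "g \<in> Hom C A B" and eq: "f \<boxplus> g = Zero C A B"
  shows "g = Neg C f"
proof -
  interpret G: comm_group "hom_group C A B"
    using hom_group hom_obj[OF f] by blast
  have "inv\<^bsub>hom_group C A B\<^esub> f = g"
    using G.inv_equality[OF G.inv_comm[of f g]] f g eq by (simp add: hom_group_def)
  then show ?thesis
    using f by (simp add: Neg_def Hom_def)
qed

lemma neg_inj:
  assumes f: "f \<in> Hom C A B" and g: "g \<in> Hom C A B" and eq: "Neg C f = Neg C g"
  shows "f = g"
proof -
  interpret G: comm_group "hom_group C A B"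
    using hom_group hom_obj[OF f] by blast
  show ?thesis
    using G.inv_inj f g eq by (simp add: Neg_def Hom_def hom_group_def inj_on_def)
qed

lemma comp_neg:
  assumes f: "f \<in> Hom C A B" and g: "g \<in> Hom C B D"
  shows "g \<cdot> Neg C f = Neg C (g \<cdot> f)"
  using neg_unique[OF comp_hom[OF f g] comp_hom[OF neg_hom[OF f] g]]
    comp_add[OF f neg_hom[OF f] g] add_neg[OF f] comp_zero[OF hom_obj(1)[OF f] g] by simp

lemma neg_comp:
  assumes f: "f \<in> Hom C A B" and g: "g \<in> Hom C B D"
  shows "Neg C g \<cdot> f = Neg C (g \<cdot> f)"
  using neg_unique[OF comp_hom[OF f g] comp_hom[OF f neg_hom[OF g]]]
    add_comp[OF f g neg_hom[OF g]] add_neg[OF g] zero_comp[OF f hom_obj(2)[OF g]] by simp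

end


section \<open>Exactness of distinguished triangles\<close>

context triangulated_category
begin

section \<open>Desuspending arrows and inverses\<close>

lemma shift_obj: "A \<in> Obj C \<Longrightarrow> A[1]\<^sub>o \<in> Obj C"
  using shift_obj_bij by (auto simp: bij_betw_def)

lemma shift_inj:
  assumes "f \<in> Hom C A B" "g \<in> Hom C A' B'" "f[1]\<^sub>m = g[1]\<^sub>m"
  shows "f = g"
  using shift_arr_bij assms by (auto simp: bij_betw_def inj_on_def Hom_def)

text \<open>Surjectivity on arrows gives a preimage; injectivity on objects then forces its domain
  and codomain to be A and B.\<close>

lemma shift_full:
  assumes f: "f \<in> Hom C (A[1]\<^sub>o) (B[1]\<^sub>o)" and A: "A \<in> Obj C" and B: "B \<in> Obj C"
  obtains g where "g \<in> Hom C A B" "f = g[1]\<^sub>m"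
proof -
  obtain g where g: "g \<in> Arr C" "f = g[1]\<^sub>m"
    using shift_arr_bij f by (auto simp: bij_betw_def Hom_def)
  have "g[1]\<^sub>m \<in> Hom C ((Dom C g)[1]\<^sub>o) ((Cod C g)[1]\<^sub>o)"
    using shift_hom[of g] g(1) by (simp add: Hom_def)
  then have "(Dom C g)[1]\<^sub>o = A[1]\<^sub>o" "(Cod C g)[1]\<^sub>o = B[1]\<^sub>o"
    using f g(2) by (auto simp: Hom_def)
  then have "Dom C g = A" "Cod C g = B"
    using shift_obj_bij A B dom_obj cod_obj g(1) by (auto simp: bij_betw_def inj_on_def)
  then show thesis
    using that g by (auto simp: Hom_def)
qed

text \<open>The inverse of the suspended arrow is a suspension by \<open>shift_full\<close>, and
  injectivity on arrows desuspends both inverse laws.\<close>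

lemma shift_reflects_iso:
  assumes f: "f \<in> Hom C A B" and iso: "iso_arr C (f[1]\<^sub>m)"
  shows "iso_arr C f"
proof -
  obtain k where k: "k \<in> Hom C (B[1]\<^sub>o) (A[1]\<^sub>o)" "k \<cdot> f[1]\<^sub>m = Idn C (A[1]\<^sub>o)"
    "f[1]\<^sub>m \<cdot> k = Idn C (B[1]\<^sub>o)"
    using iso_arrE[OF iso shift_hom[OF f]] by blast
  obtain g where g: "g \<in> Hom C B A" "k = g[1]\<^sub>m"
    using shift_full[OF k(1)] hom_obj[OF f] by blast
  have "g \<cdot> f = Idn C A"
    using shift_inj[OF comp_hom[OF f g(1)] idn_hom] shift_comp[OF f g(1)] g(2) k(2)
      shift_idn hom_obj(1)[OF f] by simp
  moreover have "f \<cdot> g = Idn C B"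
    using shift_inj[OF comp_hom[OF g(1) f] idn_hom] shift_comp[OF g(1) f] g(2) k(3)
      shift_idn hom_obj(2)[OF f] by simp
  ultimately show ?thesis
    using iso_arrI[OF f g(1) g(1)] by blast
qed

lemma shift_zero:
  assumes A: "A \<in> Obj C" "B \<in> Obj C"
  shows "(Zero C A B)[1]\<^sub>m = Zero C (A[1]\<^sub>o) (B[1]\<^sub>o)"
  using shift_add[OF zero_hom[OF A] zero_hom[OF A]] zero_add_zero[OF A]
    add_self_zero[OF shift_hom[OF zero_hom[OF A]]] by simp

lemma shift_zero_object: "zero_object C Z \<Longrightarrow> zero_object C (Z[1]\<^sub>o)"
proof -
  assume Z: "zero_object C Z"
  then have O: "Z \<in> Obj C"
    by (simp add: zero_object_def)
  show ?thesis
    using zero_objectI[OF shift_obj[OF O]] shift_idn[OF O] shift_zero[OF O O]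
      to_zero_eq[OF Z idn_hom[OF O]] by simp
qed

section \<open>Vanishing composites, weak cokernels and weak kernels in a triangle\<close>

lemma tri_homs:
  assumes "(f, g, h) \<in> Tri C" and "f \<in> Hom C A B" and "g \<in> Hom C B' D"
  shows "g \<in> Hom C B D" "h \<in> Hom C D (A[1]\<^sub>o)"
  using tri_triangle[OF assms(1)] assms(2,3) by (auto simp: Hom_def)

lemma tri_rotateD: "(f, g, h) \<in> Tri C \<Longrightarrow> (g, h, Neg C (f[1]\<^sub>m)) \<in> Tri C"
  using tri_rotate tri_triangle by blast

text \<open>The pair (identity, f) extends to a map from the trivial triangle A \<rightarrow> A
  \<rightarrow> 0, so g f factors through a zero object.\<close>

lemma tri_comp_zero:
  assumes t: "(f, g, h) \<in> Tri C" and f: "f \<in> Hom C A B" and g: "g \<in> Hom C B D"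
  shows "g \<cdot> f = Zero C A D"
proof -
  obtain Z where Z: "zero_object C Z"
    using zero_object_ex by blast
  have A: "A \<in> Obj C" and ZO: "Z \<in> Obj C"
    using hom_obj[OF f] Z by (auto simp: zero_object_def)
  have id: "Idn C A \<in> Hom C A A" and z: "Zero C A Z \<in> Hom C A Z"
    using idn_hom zero_hom A ZO by auto
  have z': "Zero C Z (A[1]\<^sub>o) \<in> Hom C Z (A[1]\<^sub>o)"
    using zero_hom[OF ZO shift_obj[OF A]] .
  obtain c where c: "triangle_map C (Idn C A, Zero C A Z, Zero C Z (A[1]\<^sub>o)) (f, g, h)
      (Idn C A, f, c)"
    using tri_fill[OF tri_idn[OF A Z] t, of "Idn C A" f] id f by (auto simp: Hom_def)
  then have "c \<in> Hom C Z D" "c \<cdot> Zero C A Z = g \<cdot> f"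
    using z' tri_homs[OF t f g] by (auto simp: Hom_def)
  then show ?thesis
    using comp_zero[OF A] by metis
qed

text \<open>This is the trivial triangle on X, taken with zero object Z[1] and rotated
  backwards.\<close>

lemma tri_zero_idn:
  assumes X: "X \<in> Obj C" and Z: "zero_object C Z"
  shows "(Zero C Z X, Idn C X, Zero C X (Z[1]\<^sub>o)) \<in> Tri C"
proof -
  have ZO: "Z \<in> Obj C"
    using Z by (simp add: zero_object_def)
  have z: "Zero C Z X \<in> Hom C Z X" "Zero C X (Z[1]\<^sub>o) \<in> Hom C X (Z[1]\<^sub>o)"
    using zero_hom ZO X shift_obj by blast+
  \<comment> \<open>The sign of the rotation is invisible because the arrow starts at the zero
    object Z[1].\<close>
  have "Neg C ((Zero C Z X)[1]\<^sub>m) = Zero C (Z[1]\<^sub>o) (X[1]\<^sub>o)"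
    using from_zero_eq[OF shift_zero_object[OF Z] neg_hom[OF shift_hom[OF z(1)]]] .
  moreover have "triangle C (Zero C Z X, Idn C X, Zero C X (Z[1]\<^sub>o))"
    using z idn_hom[OF X] by (auto simp: Hom_def)
  ultimately show ?thesis
    using tri_rotate tri_idn[OF X shift_zero_object[OF Z]] by metis
qed

text \<open>Since x f = 0, the pair (0, x) is a commutative square into the triangle 0 \<rightarrow>
  X \<rightarrow> X; its third component is the factorization.\<close>

lemma weak_cokernel:
  assumes t: "(f, g, h) \<in> Tri C" and f: "f \<in> Hom C A B" and g: "g \<in> Hom C B D"
    and x: "x \<in> Hom C B X" and xf: "x \<cdot> f = Zero C A X"
  obtains y where "y \<in> Hom C D X" "y \<cdot> g = x"
proof -
  obtain Z where Z: "zero_object C Z"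
    using zero_object_ex by blast
  have A: "A \<in> Obj C" and X: "X \<in> Obj C" and ZO: "Z \<in> Obj C"
    using hom_obj[OF f] hom_obj[OF x] Z by (auto simp: zero_object_def)
  have z: "Zero C A Z \<in> Hom C A Z" "Zero C Z X \<in> Hom C Z X" "Zero C X (Z[1]\<^sub>o) \<in> Hom C X (Z[1]\<^sub>o)"
    using zero_hom ZO X A shift_obj by blast+
  have h: "h \<in> Hom C D (A[1]\<^sub>o)"
    using tri_homs[OF t f g] by blast
  have "Zero C Z X \<cdot> Zero C A Z = Zero C A X"
    using comp_zero[OF A z(2)] .
  then obtain c where c: "triangle_map C (f, g, h) (Zero C Z X, Idn C X, Zero C X (Z[1]\<^sub>o))
      (Zero C A Z, x, c)"
    using tri_fill[OF t tri_zero_idn[OF X Z], of "Zero C A Z" x] z x f xf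
    by (auto simp: Hom_def)
  then have "c \<in> Hom C D X" "c \<cdot> g = Idn C X \<cdot> x"
    using z h by (auto simp: Hom_def)
  then show thesis
    using that idn_comp[OF x] by simp
qed

text \<open>The axiom \<open>tri_fill\<close> supplies only a third component, so both the trivial
  triangle on X and the given one are rotated once. The filler X[1] \<rightarrow> A[1] then
  desuspends to the lift of x.\<close>

lemma weak_kernel:
  assumes t: "(f, g, h) \<in> Tri C" and f: "f \<in> Hom C A B" and g: "g \<in> Hom C B D"
    and x: "x \<in> Hom C X B" and gx: "g \<cdot> x = Zero C X D"
  obtains y where "y \<in> Hom C X A" "f \<cdot> y = x"
proof -
  obtain Z where Z: "zero_object C Z"
    using zero_object_ex by blast
  have A: "A \<in> Obj C" and D: "D \<in> Obj C" and X: "X \<in> Obj C" and ZO: "Z \<in> Obj C"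
    using hom_obj[OF f] hom_obj[OF g] hom_obj[OF x] Z by (auto simp: zero_object_def)
  have z: "Zero C X Z \<in> Hom C X Z" "Zero C Z (X[1]\<^sub>o) \<in> Hom C Z (X[1]\<^sub>o)" "Zero C Z D \<in> Hom C Z D"
    using zero_hom ZO X D shift_obj by blast+
  have h: "h \<in> Hom C D (A[1]\<^sub>o)"
    using tri_homs[OF t f g] by blast
  have f1: "f[1]\<^sub>m \<in> Hom C (A[1]\<^sub>o) (B[1]\<^sub>o)" and x1: "x[1]\<^sub>m \<in> Hom C (X[1]\<^sub>o) (B[1]\<^sub>o)"
    and id1: "(Idn C X)[1]\<^sub>m \<in> Hom C (X[1]\<^sub>o) (X[1]\<^sub>o)"
    using shift_hom f x idn_hom[OF X] by blast+
  have "Zero C Z D \<cdot> Zero C X Z = Zero C X D"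
    using comp_zero[OF X z(3)] .
  then obtain c where
    "triangle_map C (Zero C X Z, Zero C Z (X[1]\<^sub>o), Neg C ((Idn C X)[1]\<^sub>m))
      (g, h, Neg C (f[1]\<^sub>m)) (x, Zero C Z D, c)"
    using tri_fill[OF tri_rotateD[OF tri_idn[OF X Z]] tri_rotateD[OF t], of x "Zero C Z D"]
      z x g gx by (auto simp: Hom_def)
  then have c: "c \<in> Hom C (X[1]\<^sub>o) (A[1]\<^sub>o)" and
    sq: "x[1]\<^sub>m \<cdot> Neg C ((Idn C X)[1]\<^sub>m) = Neg C (f[1]\<^sub>m) \<cdot> c"
    using neg_hom[OF f1] neg_hom[OF id1] by (auto simp: Hom_def)
  obtain y where y: "y \<in> Hom C X A" "c = y[1]\<^sub>m"
    using shift_full[OF c X A] by blast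
  \<comment> \<open>Rotation puts a sign on both sides of the last square, so the two
    cancel.\<close>
  have "Neg C (x[1]\<^sub>m) = Neg C (f[1]\<^sub>m \<cdot> c)"
    using sq comp_neg[OF id1 x1] neg_comp[OF c f1] shift_idn[OF X] comp_idn[OF x1] by simp
  then have "x[1]\<^sub>m = (f \<cdot> y)[1]\<^sub>m"
    using neg_inj[OF x1 comp_hom[OF c f1]] shift_comp[OF y(1) f] y(2) by simp
  then have "f \<cdot> y = x"
    using shift_inj[OF x comp_hom[OF y(1) f]] by simp
  with y(1) show thesis
    using that by blast
qed

text \<open>As A and A[1] are zero, the identity of B kills f and h kills the identity of D. The
  weak cokernel property gives a left inverse of g, the weak kernel property of the rotated triangle
  a right inverse.\<close>

lemma tri_first_zero_iso:
  assumes t: "(f, g, h) \<in> Tri C" and f: "f \<in> Hom C A B" and g: "g \<in> Hom C B D"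
    and A: "zero_object C A"
  shows "iso_arr C g"
proof -
  have h: "h \<in> Hom C D (A[1]\<^sub>o)"
    using tri_homs[OF t f g] by blast
  have B: "B \<in> Obj C" and D: "D \<in> Obj C"
    using hom_obj[OF g] by auto
  have "Idn C B \<cdot> f = Zero C A B"
    using from_zero_eq[OF A f] idn_comp[OF f] by simp
  then obtain k where k: "k \<in> Hom C D B" "k \<cdot> g = Idn C B"
    using weak_cokernel[OF t f g idn_hom[OF B]] by blast
  have "h \<cdot> Idn C D = Zero C D (A[1]\<^sub>o)"
    using to_zero_eq[OF shift_zero_object[OF A] h] comp_idn[OF h] by simp
  then obtain l where l: "l \<in> Hom C D B" "g \<cdot> l = Idn C D"
    using weak_kernel[OF tri_rotateD[OF t] g h idn_hom[OF D]] by blast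
  show ?thesis
    using iso_arrI[OF g k(1) l(1) k(2) l(2)] .
qed

text \<open>Two rotations make D the first vertex and -f[1] the second arrow, which reduces to the
  previous case.\<close>

lemma tri_third_zero_iso:
  assumes t: "(f, g, h) \<in> Tri C" and f: "f \<in> Hom C A B" and g: "g \<in> Hom C B D"
    and D: "zero_object C D"
  shows "iso_arr C f"
proof -
  have h: "h \<in> Hom C D (A[1]\<^sub>o)"
    using tri_homs[OF t f g] by blast
  have f1: "f[1]\<^sub>m \<in> Hom C (A[1]\<^sub>o) (B[1]\<^sub>o)"
    using shift_hom f by blast
  obtain k where k: "k \<in> Hom C (B[1]\<^sub>o) (A[1]\<^sub>o)" "k \<cdot> Neg C (f[1]\<^sub>m) = Idn C (A[1]\<^sub>o)"
    "Neg C (f[1]\<^sub>m) \<cdot> k = Idn C (B[1]\<^sub>o)"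
    using tri_first_zero_iso[OF tri_rotateD[OF tri_rotateD[OF t]] h neg_hom[OF f1] D]
      iso_arrE[OF _ neg_hom[OF f1]] by blast
  \<comment> \<open>If k inverts -f[1], then -k inverts f[1].\<close>
  have "iso_arr C (f[1]\<^sub>m)"
    using iso_arrI[OF f1 neg_hom[OF k(1)] neg_hom[OF k(1)]] k(2,3)
      comp_neg[OF f1 k(1)] neg_comp[OF f1 k(1)] comp_neg[OF k(1) f1] neg_comp[OF k(1) f1] by simp
  then show ?thesis
    using shift_reflects_iso[OF f] by blast
qed

end


section \<open>Tensoring\<close>

context monoidal_category
begin

lemma idn_tens_hom: "X \<in> Obj C \<Longrightarrow> f \<in> Hom C A B \<Longrightarrow> Idn C X \<otimes>\<^sub>m f \<in> Hom C (X \<otimes>\<^sub>o A) (X \<otimes>\<^sub>o B)"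
  using tens_hom[OF idn_hom] .

lemma tens_idn_hom: "X \<in> Obj C \<Longrightarrow> f \<in> Hom C A B \<Longrightarrow> f \<otimes>\<^sub>m Idn C X \<in> Hom C (A \<otimes>\<^sub>o X) (B \<otimes>\<^sub>o X)"
  using tens_hom[OF _ idn_hom] .

lemma idn_tens_comp:
  assumes "X \<in> Obj C" "f \<in> Hom C A B" "g \<in> Hom C B D"
  shows "Idn C X \<otimes>\<^sub>m (g \<cdot> f) = (Idn C X \<otimes>\<^sub>m g) \<cdot> (Idn C X \<otimes>\<^sub>m f)"
  using tens_comp[OF idn_hom[OF assms(1)] idn_hom[OF assms(1)] assms(2,3)]
    comp_idn[OF idn_hom[OF assms(1)]] by simp

lemma comp_tens_idn:
  assumes "X \<in> Obj C" "f \<in> Hom C A B" "g \<in> Hom C B D"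
  shows "(g \<cdot> f) \<otimes>\<^sub>m Idn C X = (g \<otimes>\<^sub>m Idn C X) \<cdot> (f \<otimes>\<^sub>m Idn C X)"
  using tens_comp[OF assms(2,3) idn_hom[OF assms(1)] idn_hom[OF assms(1)]]
    comp_idn[OF idn_hom[OF assms(1)]] by simp

text \<open>Both composites equal \<open>f \<otimes>\<^sub>m g\<close>.\<close>

lemma interchange:
  assumes f: "f \<in> Hom C A A'" and g: "g \<in> Hom C B B'"
  shows "(Idn C A' \<otimes>\<^sub>m g) \<cdot> (f \<otimes>\<^sub>m Idn C B) = (f \<otimes>\<^sub>m Idn C B') \<cdot> (Idn C A \<otimes>\<^sub>m g)"
  using tens_comp[OF f idn_hom[OF hom_obj(2)[OF f]] idn_hom[OF hom_obj(1)[OF g]] g]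
    tens_comp[OF idn_hom[OF hom_obj(1)[OF f]] f g idn_hom[OF hom_obj(2)[OF g]]]
    comp_idn[OF f] idn_comp[OF f] comp_idn[OF g] idn_comp[OF g] by simp

lemma idn_tens_iso:
  assumes X: "X \<in> Obj C" and f: "f \<in> Hom C A B" "iso_arr C f"
  shows "iso_arr C (Idn C X \<otimes>\<^sub>m f)"
proof -
  obtain g where g: "g \<in> Hom C B A" "g \<cdot> f = Idn C A" "f \<cdot> g = Idn C B"
    using iso_arrE[OF f(2,1)] by blast
  show ?thesis
    using iso_arrI[OF idn_tens_hom[OF X f(1)] idn_tens_hom[OF X g(1)] idn_tens_hom[OF X g(1)]]
      idn_tens_comp[OF X f(1) g(1)] idn_tens_comp[OF X g(1) f(1)] g(2,3)
      tens_idn[OF X] hom_obj[OF f(1)] by simp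
qed

lemma tens_idn_iso:
  assumes X: "X \<in> Obj C" and f: "f \<in> Hom C A B" "iso_arr C f"
  shows "iso_arr C (f \<otimes>\<^sub>m Idn C X)"
proof -
  obtain g where g: "g \<in> Hom C B A" "g \<cdot> f = Idn C A" "f \<cdot> g = Idn C B"
    using iso_arrE[OF f(2,1)] by blast
  show ?thesis
    using iso_arrI[OF tens_idn_hom[OF X f(1)] tens_idn_hom[OF X g(1)] tens_idn_hom[OF X g(1)]]
      comp_tens_idn[OF X f(1) g(1)] comp_tens_idn[OF X g(1) f(1)] g(2,3)
      tens_idn[OF _ X] hom_obj[OF f(1)] by simp
qed

lemma tens_isomorphic_left: "X \<in> Obj C \<Longrightarrow> A \<simeq> B \<Longrightarrow> X \<otimes>\<^sub>o A \<simeq> X \<otimes>\<^sub>o B"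
  using idn_tens_iso idn_tens_hom isomorphicI unfolding isomorphic_def by meson

lemma tens_isomorphic_right: "X \<in> Obj C \<Longrightarrow> A \<simeq> B \<Longrightarrow> A \<otimes>\<^sub>o X \<simeq> B \<otimes>\<^sub>o X"
  using tens_idn_iso tens_idn_hom isomorphicI unfolding isomorphic_def by meson

lemma asc_isomorphic:
  "A \<in> Obj C \<Longrightarrow> B \<in> Obj C \<Longrightarrow> D \<in> Obj C \<Longrightarrow> (A \<otimes>\<^sub>o B) \<otimes>\<^sub>o D \<simeq> A \<otimes>\<^sub>o (B \<otimes>\<^sub>o D)"
  using isomorphicI[OF asc_hom asc_iso] .

lemma lun_isomorphic: "A \<in> Obj C \<Longrightarrow> Unt C \<otimes>\<^sub>o A \<simeq> A"
  using isomorphicI[OF lun_hom lun_iso] .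

lemma run_isomorphic: "A \<in> Obj C \<Longrightarrow> A \<otimes>\<^sub>o Unt C \<simeq> A"
  using isomorphicI[OF run_hom run_iso] .

text \<open>Naturality in A of the map A \<otimes> P \<rightarrow> A induced by e : P \<rightarrow>
  1, from interchange and naturality of the right unitor. With e = \<epsilon> it compares f with f
  \<otimes> K.\<close>

lemma run_tens_square:
  assumes f: "f \<in> Hom C A B" and e: "e \<in> Hom C P (Unt C)"
  shows "(Run C B \<cdot> (Idn C B \<otimes>\<^sub>m e)) \<cdot> (f \<otimes>\<^sub>m Idn C P) = f \<cdot> (Run C A \<cdot> (Idn C A \<otimes>\<^sub>m e))"
proof -
  have O: "A \<in> Obj C" "B \<in> Obj C" "P \<in> Obj C" "Unt C \<in> Obj C"
    using hom_obj[OF f] hom_obj[OF e] by auto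
  show ?thesis
    using comp_assoc[OF tens_idn_hom[OF O(3) f] idn_tens_hom[OF O(2) e] run_hom[OF O(2)]]
      comp_assoc[OF idn_tens_hom[OF O(1) e] tens_idn_hom[OF O(4) f] run_hom[OF O(2)]]
      comp_assoc[OF idn_tens_hom[OF O(1) e] run_hom[OF O(1)] f]
      interchange[OF f e] run_nat[OF f] by simp
qed

lemma lun_tens_square:
  assumes f: "f \<in> Hom C A B" and e: "e \<in> Hom C P (Unt C)"
  shows "(Lun C B \<cdot> (e \<otimes>\<^sub>m Idn C B)) \<cdot> (Idn C P \<otimes>\<^sub>m f) = f \<cdot> (Lun C A \<cdot> (e \<otimes>\<^sub>m Idn C A))"
proof -
  have O: "A \<in> Obj C" "B \<in> Obj C" "P \<in> Obj C" "Unt C \<in> Obj C"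
    using hom_obj[OF f] hom_obj[OF e] by auto
  show ?thesis
    using comp_assoc[OF idn_tens_hom[OF O(3) f] tens_idn_hom[OF O(2) e] lun_hom[OF O(2)]]
      comp_assoc[OF tens_idn_hom[OF O(1) e] idn_tens_hom[OF O(4) f] lun_hom[OF O(2)]]
      comp_assoc[OF tens_idn_hom[OF O(1) e] lun_hom[OF O(1)] f]
      interchange[OF e f] lun_nat[OF f] by simp
qed

text \<open>The left unitor conjugates 1 \<otimes> f back to f.\<close>

lemma lun_faithful:
  assumes f: "f \<in> Hom C A B" and f': "f' \<in> Hom C A B"
    and eq: "Idn C (Unt C) \<otimes>\<^sub>m f = Idn C (Unt C) \<otimes>\<^sub>m f'"
  shows "f = f'"
  using iso_epi[OF f f' lun_hom lun_iso] lun_nat[OF f] lun_nat[OF f'] eq hom_obj(1)[OF f] by simp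

end

section \<open>Tensoring with zero objects and zero arrows\<close>

context triangulated_monoidal_category
begin

text \<open>Exactness stands in for additivity: tensoring a triangle on Z whose first two arrows are
  identities keeps them identities, and consecutive arrows of a triangle compose to zero.\<close>

lemma tens_zero_object:
  assumes X: "X \<in> Obj C" and Z: "zero_object C Z"
  shows "zero_object C (X \<otimes>\<^sub>o Z)"
proof -
  have ZO: "Z \<in> Obj C"
    using Z by (simp add: zero_object_def)
  have XZ: "X \<otimes>\<^sub>o Z \<in> Obj C"
    using tens_obj X ZO .
  \<comment> \<open>In the trivial triangle on Z with zero object Z, the second arrow is the zero
    endomorphism of Z, that is, its identity.\<close>
  obtain h where "(Idn C (X \<otimes>\<^sub>o Z), Idn C (X \<otimes>\<^sub>o Z), h) \<in> Tri C"
    using tri_tens_left[OF tri_idn[OF ZO Z] X] to_zero_eq[OF Z idn_hom[OF ZO]] tens_idn[OF X ZO]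
    by auto
  then show ?thesis
    using zero_objectI[OF XZ] tri_comp_zero[OF _ idn_hom[OF XZ] idn_hom[OF XZ]]
      comp_idn[OF idn_hom[OF XZ]] by simp
qed

lemma zero_object_tens:
  assumes X: "X \<in> Obj C" and Z: "zero_object C Z"
  shows "zero_object C (Z \<otimes>\<^sub>o X)"
proof -
  have ZO: "Z \<in> Obj C"
    using Z by (simp add: zero_object_def)
  have ZX: "Z \<otimes>\<^sub>o X \<in> Obj C"
    using tens_obj ZO X .
  obtain h where "(Idn C (Z \<otimes>\<^sub>o X), Idn C (Z \<otimes>\<^sub>o X), h) \<in> Tri C"
    using tri_tens_right[OF tri_idn[OF ZO Z] X] to_zero_eq[OF Z idn_hom[OF ZO]] tens_idn[OF ZO X]
    by auto
  then show ?thesis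
    using zero_objectI[OF ZX] tri_comp_zero[OF _ idn_hom[OF ZX] idn_hom[OF ZX]]
      comp_idn[OF idn_hom[OF ZX]] by simp
qed

text \<open>The zero arrow factors through a zero object Z, so its tensor product with X factors
  through X \<otimes> Z, again a zero object.\<close>

lemma idn_tens_zero:
  assumes X: "X \<in> Obj C" and A: "A \<in> Obj C" and B: "B \<in> Obj C"
  shows "Idn C X \<otimes>\<^sub>m Zero C A B = Zero C (X \<otimes>\<^sub>o A) (X \<otimes>\<^sub>o B)"
proof -
  obtain Z where Z: "zero_object C Z"
    using zero_object_ex by blast
  have z: "Zero C A Z \<in> Hom C A Z" "Zero C Z B \<in> Hom C Z B"
    using zero_hom A B Z by (auto simp: zero_object_def)
  have "Idn C X \<otimes>\<^sub>m Zero C A B = (Idn C X \<otimes>\<^sub>m Zero C Z B) \<cdot> (Idn C X \<otimes>\<^sub>m Zero C A Z)"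
    using comp_zero[OF A z(2)] idn_tens_comp[OF X z] by simp
  also have "\<dots> = Zero C (X \<otimes>\<^sub>o A) (X \<otimes>\<^sub>o B)"
    using factor_zero[OF tens_zero_object[OF X Z] idn_tens_hom[OF X z(1)] idn_tens_hom[OF X z(2)]] .
  finally show ?thesis .
qed

lemma zero_tens_idn:
  assumes X: "X \<in> Obj C" and A: "A \<in> Obj C" and B: "B \<in> Obj C"
  shows "Zero C A B \<otimes>\<^sub>m Idn C X = Zero C (A \<otimes>\<^sub>o X) (B \<otimes>\<^sub>o X)"
proof -
  obtain Z where Z: "zero_object C Z"
    using zero_object_ex by blast
  have z: "Zero C A Z \<in> Hom C A Z" "Zero C Z B \<in> Hom C Z B"
    using zero_hom A B Z by (auto simp: zero_object_def)
  have "Zero C A B \<otimes>\<^sub>m Idn C X = (Zero C Z B \<otimes>\<^sub>m Idn C X) \<cdot> (Zero C A Z \<otimes>\<^sub>m Idn C X)"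
    using comp_zero[OF A z(2)] comp_tens_idn[OF X z] by simp
  also have "\<dots> = Zero C (A \<otimes>\<^sub>o X) (B \<otimes>\<^sub>o X)"
    using factor_zero[OF zero_object_tens[OF X Z] tens_idn_hom[OF X z(1)] tens_idn_hom[OF X z(2)]] .
  finally show ?thesis .
qed

end


section \<open>Complementary idempotents\<close>

text \<open>The letter \<open>C\<close> is taken by the category, so the counital idempotent is
  called \<open>K\<close>.\<close>

locale complementary_pair = triangulated_monoidal_category C
  for C :: "('o, 'm, 'z) tmcat_scheme" (structure) +
  fixes K U :: 'o and \<epsilon> \<eta> \<delta> :: 'm
  assumes complementary: "complementary_idempotents C K U \<epsilon> \<eta> \<delta>"
begin

lemma K_obj: "K \<in> Obj C" and U_obj: "U \<in> Obj C"
  and eps_hom: "\<epsilon> \<in> Hom C K (Unt C)" and eta_hom: "\<eta> \<in> Hom C (Unt C) U"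
  and delta_hom: "\<delta> \<in> Hom C U (K[1]\<^sub>o)"
  and tri: "(\<epsilon>, \<eta>, \<delta>) \<in> Tri C"
  using complementary by (auto simp: complementary_idempotents_def)

lemma KU_zero: "zero_object C (K \<otimes>\<^sub>o U)" and UK_zero: "zero_object C (U \<otimes>\<^sub>o K)"
  using complementary zero_object_isomorphic by (auto simp: complementary_idempotents_def)

section \<open>Tensoring the defining triangle with an object, and absorption criteria\<close>

lemma eps_tens_hom: "X \<in> Obj C \<Longrightarrow> \<epsilon> \<otimes>\<^sub>m Idn C X \<in> Hom C (K \<otimes>\<^sub>o X) (Unt C \<otimes>\<^sub>o X)"
  and tens_eps_hom: "X \<in> Obj C \<Longrightarrow> Idn C X \<otimes>\<^sub>m \<epsilon> \<in> Hom C (X \<otimes>\<^sub>o K) (X \<otimes>\<^sub>o Unt C)"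
  and eta_tens_hom: "X \<in> Obj C \<Longrightarrow> \<eta> \<otimes>\<^sub>m Idn C X \<in> Hom C (Unt C \<otimes>\<^sub>o X) (U \<otimes>\<^sub>o X)"
  and tens_eta_hom: "X \<in> Obj C \<Longrightarrow> Idn C X \<otimes>\<^sub>m \<eta> \<in> Hom C (X \<otimes>\<^sub>o Unt C) (X \<otimes>\<^sub>o U)"
  using tens_idn_hom idn_tens_hom eps_hom eta_hom by auto

lemma eps_tens_iso:
  "X \<in> Obj C \<Longrightarrow> zero_object C (U \<otimes>\<^sub>o X) \<Longrightarrow> iso_arr C (\<epsilon> \<otimes>\<^sub>m Idn C X)"
  using tri_third_zero_iso[OF tri_tens_right[OF tri] eps_tens_hom eta_tens_hom] .

lemma tens_eps_iso:
  "X \<in> Obj C \<Longrightarrow> zero_object C (X \<otimes>\<^sub>o U) \<Longrightarrow> iso_arr C (Idn C X \<otimes>\<^sub>m \<epsilon>)"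
  using tri_third_zero_iso[OF tri_tens_left[OF tri] tens_eps_hom tens_eta_hom] .

lemma eta_tens_iso:
  "X \<in> Obj C \<Longrightarrow> zero_object C (K \<otimes>\<^sub>o X) \<Longrightarrow> iso_arr C (\<eta> \<otimes>\<^sub>m Idn C X)"
  using tri_first_zero_iso[OF tri_tens_right[OF tri] eps_tens_hom eta_tens_hom] .

lemma tens_eta_iso:
  "X \<in> Obj C \<Longrightarrow> zero_object C (X \<otimes>\<^sub>o K) \<Longrightarrow> iso_arr C (Idn C X \<otimes>\<^sub>m \<eta>)"
  using tri_first_zero_iso[OF tri_tens_left[OF tri] tens_eps_hom tens_eta_hom] .

text \<open>The isomorphism on the left is arbitrary, not assumed to come from \<eta>: it already
  gives K \<otimes> X \<simeq> K \<otimes> (U \<otimes> X) \<simeq> (K \<otimes> U) \<otimes> X,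
  which is zero. Conversely \<eta> \<otimes> X is invertible and is combined with the left unitor.
  The next three criteria follow the same pattern.\<close>

lemma U_tens_iff:
  assumes X: "X \<in> Obj C"
  shows "U \<otimes>\<^sub>o X \<simeq> X \<longleftrightarrow> zero_object C (K \<otimes>\<^sub>o X)"
proof
  assume "U \<otimes>\<^sub>o X \<simeq> X"
  then have "K \<otimes>\<^sub>o X \<simeq> (K \<otimes>\<^sub>o U) \<otimes>\<^sub>o X"
    using isomorphic_sym isomorphic_trans tens_isomorphic_left[OF K_obj]
      asc_isomorphic[OF K_obj U_obj X] by meson
  then show "zero_object C (K \<otimes>\<^sub>o X)"
    using zero_object_isomorphic zero_object_tens[OF X KU_zero] by blast
next
  assume "zero_object C (K \<otimes>\<^sub>o X)"
  then show "U \<otimes>\<^sub>o X \<simeq> X"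
    using isomorphicI[OF eta_tens_hom[OF X] eta_tens_iso[OF X]] lun_isomorphic[OF X]
      isomorphic_sym isomorphic_trans by blast
qed

lemma tens_U_iff:
  assumes X: "X \<in> Obj C"
  shows "X \<otimes>\<^sub>o U \<simeq> X \<longleftrightarrow> zero_object C (X \<otimes>\<^sub>o K)"
proof
  assume "X \<otimes>\<^sub>o U \<simeq> X"
  then have "X \<otimes>\<^sub>o K \<simeq> X \<otimes>\<^sub>o (U \<otimes>\<^sub>o K)"
    using isomorphic_sym isomorphic_trans tens_isomorphic_right[OF K_obj]
      asc_isomorphic[OF X U_obj K_obj] by meson
  then show "zero_object C (X \<otimes>\<^sub>o K)"
    using zero_object_isomorphic tens_zero_object[OF X UK_zero] by blast
next
  assume "zero_object C (X \<otimes>\<^sub>o K)"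
  then show "X \<otimes>\<^sub>o U \<simeq> X"
    using isomorphicI[OF tens_eta_hom[OF X] tens_eta_iso[OF X]] run_isomorphic[OF X]
      isomorphic_sym isomorphic_trans by blast
qed

lemma K_tens_iff:
  assumes X: "X \<in> Obj C"
  shows "K \<otimes>\<^sub>o X \<simeq> X \<longleftrightarrow> zero_object C (U \<otimes>\<^sub>o X)"
proof
  assume "K \<otimes>\<^sub>o X \<simeq> X"
  then have "U \<otimes>\<^sub>o X \<simeq> (U \<otimes>\<^sub>o K) \<otimes>\<^sub>o X"
    using isomorphic_sym isomorphic_trans tens_isomorphic_left[OF U_obj]
      asc_isomorphic[OF U_obj K_obj X] by meson
  then show "zero_object C (U \<otimes>\<^sub>o X)"
    using zero_object_isomorphic zero_object_tens[OF X UK_zero] by blast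
next
  assume "zero_object C (U \<otimes>\<^sub>o X)"
  then show "K \<otimes>\<^sub>o X \<simeq> X"
    using isomorphicI[OF eps_tens_hom[OF X] eps_tens_iso[OF X]] lun_isomorphic[OF X]
      isomorphic_trans by blast
qed

lemma tens_K_iff:
  assumes X: "X \<in> Obj C"
  shows "X \<otimes>\<^sub>o K \<simeq> X \<longleftrightarrow> zero_object C (X \<otimes>\<^sub>o U)"
proof
  assume "X \<otimes>\<^sub>o K \<simeq> X"
  then have "X \<otimes>\<^sub>o U \<simeq> X \<otimes>\<^sub>o (K \<otimes>\<^sub>o U)"
    using isomorphic_sym isomorphic_trans tens_isomorphic_right[OF U_obj]
      asc_isomorphic[OF X K_obj U_obj] by meson
  then show "zero_object C (X \<otimes>\<^sub>o U)"
    using zero_object_isomorphic tens_zero_object[OF X KU_zero] by blast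
next
  assume "zero_object C (X \<otimes>\<^sub>o U)"
  then show "X \<otimes>\<^sub>o K \<simeq> X"
    using isomorphicI[OF tens_eps_hom[OF X] tens_eps_iso[OF X]] run_isomorphic[OF X]
      isomorphic_trans by blast
qed

text \<open>Since U \<otimes> A is zero, \<epsilon> induces an isomorphism K \<otimes> A
  \<rightarrow> A. By naturality, f after it factors through K \<otimes> B, which is zero.\<close>

lemma left_orthogonal:
  assumes f: "f \<in> Hom C A B" and A: "zero_object C (U \<otimes>\<^sub>o A)" and B: "zero_object C (K \<otimes>\<^sub>o B)"
  shows "f = Zero C A B"
proof -
  have O: "A \<in> Obj C" "B \<in> Obj C"
    using hom_obj[OF f] by auto
  have e: "Lun C X \<cdot> (\<epsilon> \<otimes>\<^sub>m Idn C X) \<in> Hom C (K \<otimes>\<^sub>o X) X" if "X \<in> Obj C" for X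
    using comp_hom[OF eps_tens_hom lun_hom] that by blast
  have iso: "iso_arr C (Lun C A \<cdot> (\<epsilon> \<otimes>\<^sub>m Idn C A))"
    using iso_comp[OF eps_tens_hom eps_tens_iso lun_hom lun_iso] O(1) A by blast
  have "f \<cdot> (Lun C A \<cdot> (\<epsilon> \<otimes>\<^sub>m Idn C A)) = Zero C (K \<otimes>\<^sub>o A) B"
    using lun_tens_square[OF f eps_hom] factor_zero[OF B idn_tens_hom[OF K_obj f] e[OF O(2)]]
    by simp
  then show ?thesis
    using iso_epi[OF f zero_hom[OF O] e[OF O(1)] iso] zero_comp[OF e[OF O(1)] O(2)] by simp
qed

text \<open>The mirror image, with the isomorphism A \<otimes> K \<rightarrow> A and a factorization
  through B \<otimes> K.\<close>

lemma right_orthogonal: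
  assumes f: "f \<in> Hom C A B" and A: "zero_object C (A \<otimes>\<^sub>o U)" and B: "zero_object C (B \<otimes>\<^sub>o K)"
  shows "f = Zero C A B"
proof -
  have O: "A \<in> Obj C" "B \<in> Obj C"
    using hom_obj[OF f] by auto
  have e: "Run C X \<cdot> (Idn C X \<otimes>\<^sub>m \<epsilon>) \<in> Hom C (X \<otimes>\<^sub>o K) X" if "X \<in> Obj C" for X
    using comp_hom[OF tens_eps_hom run_hom] that by blast
  have iso: "iso_arr C (Run C A \<cdot> (Idn C A \<otimes>\<^sub>m \<epsilon>))"
    using iso_comp[OF tens_eps_hom tens_eps_iso run_hom run_iso] O(1) A by blast
  have "f \<cdot> (Run C A \<cdot> (Idn C A \<otimes>\<^sub>m \<epsilon>)) = Zero C (A \<otimes>\<^sub>o K) B"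
    using run_tens_square[OF f eps_hom] factor_zero[OF B tens_idn_hom[OF K_obj f] e[OF O(2)]]
    by simp
  then show ?thesis
    using iso_epi[OF f zero_hom[OF O] e[OF O(1)] iso] zero_comp[OF e[OF O(1)] O(2)] by simp
qed

text \<open>K \<otimes> \<epsilon> is invertible because K \<otimes> U is zero. Hence K \<otimes>
  \<epsilon> \<otimes> X is, up to associators, both invertible and zero, so its codomain K
  \<otimes> (1 \<otimes> X) \<simeq> K \<otimes> X is zero.\<close>

lemma eps_tens_zeroD:
  assumes X: "X \<in> Obj C" and eq: "\<epsilon> \<otimes>\<^sub>m Idn C X = Zero C (K \<otimes>\<^sub>o X) (Unt C \<otimes>\<^sub>o X)"
  shows "zero_object C (K \<otimes>\<^sub>o X)"
proof -
  note asc = asc_hom[OF K_obj K_obj X] asc_hom[OF K_obj unt_obj X]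
  note asc' = asc_iso[OF K_obj K_obj X] asc_iso[OF K_obj unt_obj X]
  have h: "Idn C K \<otimes>\<^sub>m (\<epsilon> \<otimes>\<^sub>m Idn C X) \<in> Hom C (K \<otimes>\<^sub>o (K \<otimes>\<^sub>o X)) (K \<otimes>\<^sub>o (Unt C \<otimes>\<^sub>o X))"
    using idn_tens_hom[OF K_obj eps_tens_hom[OF X]] .
  have "iso_arr C ((Idn C K \<otimes>\<^sub>m \<epsilon>) \<otimes>\<^sub>m Idn C X)"
    using tens_idn_iso[OF X tens_eps_hom[OF K_obj] tens_eps_iso[OF K_obj KU_zero]] .
  then have "iso_arr C ((Idn C K \<otimes>\<^sub>m (\<epsilon> \<otimes>\<^sub>m Idn C X)) \<cdot> Asc C K K X)"
    using iso_comp[OF tens_idn_hom[OF X tens_eps_hom[OF K_obj]] _ asc(2) asc'(2)]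
      asc_nat[OF idn_hom[OF K_obj] eps_hom idn_hom[OF X]] by simp
  then have "iso_arr C (Idn C K \<otimes>\<^sub>m (\<epsilon> \<otimes>\<^sub>m Idn C X))"
    using iso_cancel_right[OF asc(1) asc'(1) h] by blast
  then have "zero_object C (K \<otimes>\<^sub>o (Unt C \<otimes>\<^sub>o X))"
    using zero_iso_zero_object[OF hom_obj[OF h]] eq
      idn_tens_zero[OF K_obj hom_obj[OF eps_tens_hom[OF X]]] by simp
  then show ?thesis
    using zero_object_isomorphic isomorphic_sym tens_isomorphic_left[OF K_obj lun_isomorphic[OF X]]
    by blast
qed

text \<open>The mirror image: \<epsilon> \<otimes> K is invertible because U \<otimes> K is zero,
  and X is tensored on the left.\<close>

lemma tens_eps_zeroD:
  assumes X: "X \<in> Obj C" and eq: "Idn C X \<otimes>\<^sub>m \<epsilon> = Zero C (X \<otimes>\<^sub>o K) (X \<otimes>\<^sub>o Unt C)"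
  shows "zero_object C (X \<otimes>\<^sub>o K)"
proof -
  note asc = asc_hom[OF X K_obj K_obj] asc_hom[OF X unt_obj K_obj]
  note asc' = asc_iso[OF X K_obj K_obj] asc_iso[OF X unt_obj K_obj]
  have h: "(Idn C X \<otimes>\<^sub>m \<epsilon>) \<otimes>\<^sub>m Idn C K \<in> Hom C ((X \<otimes>\<^sub>o K) \<otimes>\<^sub>o K) ((X \<otimes>\<^sub>o Unt C) \<otimes>\<^sub>o K)"
    using tens_idn_hom[OF K_obj tens_eps_hom[OF X]] .
  have "iso_arr C (Idn C X \<otimes>\<^sub>m (\<epsilon> \<otimes>\<^sub>m Idn C K))"
    using idn_tens_iso[OF X eps_tens_hom[OF K_obj] eps_tens_iso[OF K_obj UK_zero]] .
  then have "iso_arr C (Asc C X (Unt C) K \<cdot> ((Idn C X \<otimes>\<^sub>m \<epsilon>) \<otimes>\<^sub>m Idn C K))"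
    using iso_comp[OF asc(1) asc'(1) idn_tens_hom[OF X eps_tens_hom[OF K_obj]]]
      asc_nat[OF idn_hom[OF X] eps_hom idn_hom[OF K_obj]] by simp
  then have "iso_arr C ((Idn C X \<otimes>\<^sub>m \<epsilon>) \<otimes>\<^sub>m Idn C K)"
    using iso_cancel_left[OF h asc(2) asc'(2)] by blast
  then have "zero_object C ((X \<otimes>\<^sub>o Unt C) \<otimes>\<^sub>o K)"
    using zero_iso_zero_object[OF hom_obj[OF h]] eq
      zero_tens_idn[OF K_obj hom_obj[OF tens_eps_hom[OF X]]] by simp
  then show ?thesis
    using zero_object_isomorphic isomorphic_sym tens_isomorphic_right[OF K_obj run_isomorphic[OF X]]
    by blast
qed

text \<open>A triangle gives only weak cokernels, so cancelling \<eta> needs the tensor product.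
  Invertibility of U \<otimes> \<eta> yields U \<otimes> f = U \<otimes> f'; interchange with \<eta>
  and invertibility of \<eta> \<otimes> B carry this over to 1 \<otimes> f = 1 \<otimes> f'.\<close>

lemma eta_epi:
  assumes f: "f \<in> Hom C U B" and f': "f' \<in> Hom C U B" and eq: "f \<cdot> \<eta> = f' \<cdot> \<eta>"
    and B: "zero_object C (K \<otimes>\<^sub>o B)"
  shows "f = f'"
proof -
  have BO: "B \<in> Obj C"
    using hom_obj[OF f] by blast
  have "Idn C U \<otimes>\<^sub>m f = Idn C U \<otimes>\<^sub>m f'"
    using iso_epi[OF idn_tens_hom[OF U_obj f] idn_tens_hom[OF U_obj f'] tens_eta_hom[OF U_obj]
        tens_eta_iso[OF U_obj UK_zero]]
      idn_tens_comp[OF U_obj eta_hom f] idn_tens_comp[OF U_obj eta_hom f'] eq by simp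
  then have "Idn C (Unt C) \<otimes>\<^sub>m f = Idn C (Unt C) \<otimes>\<^sub>m f'"
    using iso_mono[OF idn_tens_hom[OF unt_obj f] idn_tens_hom[OF unt_obj f'] eta_tens_hom[OF BO]
        eta_tens_iso[OF BO B]] interchange[OF eta_hom f] interchange[OF eta_hom f'] by simp
  then show ?thesis
    using lun_faithful[OF f f'] by blast
qed

text \<open>Dual argument: K \<otimes> \<epsilon> is cancelled on the left to give K \<otimes> f = K
  \<otimes> f', then \<epsilon> \<otimes> A on the right to reach the unit.\<close>

lemma eps_mono:
  assumes f: "f \<in> Hom C A K" and f': "f' \<in> Hom C A K" and eq: "\<epsilon> \<cdot> f = \<epsilon> \<cdot> f'"
    and A: "zero_object C (U \<otimes>\<^sub>o A)"
  shows "f = f'"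
proof -
  have AO: "A \<in> Obj C"
    using hom_obj[OF f] by blast
  have "Idn C K \<otimes>\<^sub>m f = Idn C K \<otimes>\<^sub>m f'"
    using iso_mono[OF idn_tens_hom[OF K_obj f] idn_tens_hom[OF K_obj f'] tens_eps_hom[OF K_obj]
        tens_eps_iso[OF K_obj KU_zero]]
      idn_tens_comp[OF K_obj f eps_hom] idn_tens_comp[OF K_obj f' eps_hom] eq by simp
  then have "Idn C (Unt C) \<otimes>\<^sub>m f = Idn C (Unt C) \<otimes>\<^sub>m f'"
    using iso_epi[OF idn_tens_hom[OF unt_obj f] idn_tens_hom[OF unt_obj f'] eps_tens_hom[OF AO]
        eps_tens_iso[OF AO A]] interchange[OF eps_hom f] interchange[OF eps_hom f'] by simp
  then show ?thesis
    using lun_faithful[OF f f'] by blast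
qed

end

section \<open>Two pairs compared through the composite
  \<open>\<eta>2 \<cdot> \<epsilon>1\<close>\<close>

locale complementary_pairs =
  L: complementary_pair C K1 U1 \<epsilon>1 \<eta>1 \<delta>1 + R: complementary_pair C K2 U2 \<epsilon>2 \<eta>2 \<delta>2
  for C :: "('o, 'm, 'z) tmcat_scheme" (structure) and K1 U1 \<epsilon>1 \<eta>1 \<delta>1 K2 U2 \<epsilon>2 \<eta>2 \<delta>2
begin

lemma eta_eps_hom: "\<eta>2 \<cdot> \<epsilon>1 \<in> Hom C K1 U2"
  using L.comp_hom L.eps_hom R.eta_hom by blast

text \<open>Forward is orthogonality for an arrow from K1 to U2, using that U1 \<otimes> K1 is zero.
  Backward, tensor the composite with U2 and cancel \<eta>2 \<otimes> U2, invertible as K2 \<otimes>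
  U2 is zero; this leaves \<epsilon>1 \<otimes> U2 = 0.\<close>

lemma K1_U2_zero_iff: "zero_object C (K1 \<otimes>\<^sub>o U2) \<longleftrightarrow> \<eta>2 \<cdot> \<epsilon>1 = Zero C K1 U2"
proof
  assume "zero_object C (K1 \<otimes>\<^sub>o U2)"
  then show "\<eta>2 \<cdot> \<epsilon>1 = Zero C K1 U2"
    using L.left_orthogonal[OF eta_eps_hom L.UK_zero] by blast
next
  assume "\<eta>2 \<cdot> \<epsilon>1 = Zero C K1 U2"
  then have "(\<eta>2 \<otimes>\<^sub>m Idn C U2) \<cdot> (\<epsilon>1 \<otimes>\<^sub>m Idn C U2) = Zero C (K1 \<otimes>\<^sub>o U2) (U2 \<otimes>\<^sub>o U2)"
    using L.comp_tens_idn[OF R.U_obj L.eps_hom R.eta_hom]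
      L.zero_tens_idn[OF R.U_obj L.K_obj R.U_obj] by simp
  then have "\<epsilon>1 \<otimes>\<^sub>m Idn C U2 = Zero C (K1 \<otimes>\<^sub>o U2) (Unt C \<otimes>\<^sub>o U2)"
    using L.iso_mono[OF L.eps_tens_hom[OF R.U_obj] L.zero_hom R.eta_tens_hom[OF R.U_obj]
        R.eta_tens_iso[OF R.U_obj R.KU_zero]] L.comp_zero[OF _ R.eta_tens_hom[OF R.U_obj]]
      L.hom_obj[OF L.eps_tens_hom[OF R.U_obj]] by simp
  then show "zero_object C (K1 \<otimes>\<^sub>o U2)"
    using L.eps_tens_zeroD[OF R.U_obj] by blast
qed

text \<open>The same argument with tensor factors on the other side. Without a symmetry of
  \<otimes>, it is the vanishing of \<open>\<eta>2 \<cdot> \<epsilon>1\<close> that links U2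
  \<otimes> K1 to K1 \<otimes> U2.\<close>

lemma U2_K1_zero_iff: "zero_object C (U2 \<otimes>\<^sub>o K1) \<longleftrightarrow> \<eta>2 \<cdot> \<epsilon>1 = Zero C K1 U2"
proof
  assume "zero_object C (U2 \<otimes>\<^sub>o K1)"
  then show "\<eta>2 \<cdot> \<epsilon>1 = Zero C K1 U2"
    using L.right_orthogonal[OF eta_eps_hom L.KU_zero] by blast
next
  assume "\<eta>2 \<cdot> \<epsilon>1 = Zero C K1 U2"
  then have "(Idn C U2 \<otimes>\<^sub>m \<eta>2) \<cdot> (Idn C U2 \<otimes>\<^sub>m \<epsilon>1) = Zero C (U2 \<otimes>\<^sub>o K1) (U2 \<otimes>\<^sub>o U2)"
    using L.idn_tens_comp[OF R.U_obj L.eps_hom R.eta_hom]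
      L.idn_tens_zero[OF R.U_obj L.K_obj R.U_obj] by simp
  then have "Idn C U2 \<otimes>\<^sub>m \<epsilon>1 = Zero C (U2 \<otimes>\<^sub>o K1) (U2 \<otimes>\<^sub>o Unt C)"
    using L.iso_mono[OF L.tens_eps_hom[OF R.U_obj] L.zero_hom R.tens_eta_hom[OF R.U_obj]
        R.tens_eta_iso[OF R.U_obj R.UK_zero]] L.comp_zero[OF _ R.tens_eta_hom[OF R.U_obj]]
      L.hom_obj[OF L.tens_eps_hom[OF R.U_obj]] by simp
  then show "zero_object C (U2 \<otimes>\<^sub>o K1)"
    using L.tens_eps_zeroD[OF R.U_obj] by blast
qed

text \<open>\<eta>1 is a weak cokernel of \<epsilon>1.\<close>

lemma factor_eta_iff:
  "(\<exists>\<nu> \<in> Hom C U1 U2. \<nu> \<cdot> \<eta>1 = \<eta>2) \<longleftrightarrow> \<eta>2 \<cdot> \<epsilon>1 = Zero C K1 U2"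
proof
  assume "\<exists>\<nu> \<in> Hom C U1 U2. \<nu> \<cdot> \<eta>1 = \<eta>2"
  then obtain \<nu> where \<nu>: "\<nu> \<in> Hom C U1 U2" "\<nu> \<cdot> \<eta>1 = \<eta>2"
    by blast
  have "\<eta>2 \<cdot> \<epsilon>1 = \<nu> \<cdot> (\<eta>1 \<cdot> \<epsilon>1)"
    using L.comp_assoc[OF L.eps_hom L.eta_hom \<nu>(1)] \<nu>(2) by simp
  then show "\<eta>2 \<cdot> \<epsilon>1 = Zero C K1 U2"
    using L.tri_comp_zero[OF L.tri L.eps_hom L.eta_hom] L.comp_zero[OF L.K_obj \<nu>(1)] by simp
next
  assume "\<eta>2 \<cdot> \<epsilon>1 = Zero C K1 U2"
  then show "\<exists>\<nu> \<in> Hom C U1 U2. \<nu> \<cdot> \<eta>1 = \<eta>2"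
    using L.weak_cokernel[OF L.tri L.eps_hom L.eta_hom R.eta_hom] by blast
qed

text \<open>\<epsilon>2 is a weak kernel of \<eta>2.\<close>

lemma factor_eps_iff:
  "(\<exists>\<theta> \<in> Hom C K1 K2. \<epsilon>2 \<cdot> \<theta> = \<epsilon>1) \<longleftrightarrow> \<eta>2 \<cdot> \<epsilon>1 = Zero C K1 U2"
proof
  assume "\<exists>\<theta> \<in> Hom C K1 K2. \<epsilon>2 \<cdot> \<theta> = \<epsilon>1"
  then obtain \<theta> where \<theta>: "\<theta> \<in> Hom C K1 K2" "\<epsilon>2 \<cdot> \<theta> = \<epsilon>1"
    by blast
  have "\<eta>2 \<cdot> \<epsilon>1 = (\<eta>2 \<cdot> \<epsilon>2) \<cdot> \<theta>"
    using L.comp_assoc[OF \<theta>(1) R.eps_hom R.eta_hom] \<theta>(2) by simp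
  then show "\<eta>2 \<cdot> \<epsilon>1 = Zero C K1 U2"
    using L.tri_comp_zero[OF R.tri R.eps_hom R.eta_hom] L.zero_comp[OF \<theta>(1) R.U_obj] by simp
next
  assume "\<eta>2 \<cdot> \<epsilon>1 = Zero C K1 U2"
  then show "\<exists>\<theta> \<in> Hom C K1 K2. \<epsilon>2 \<cdot> \<theta> = \<epsilon>1"
    using L.weak_kernel[OF R.tri R.eps_hom R.eta_hom L.eps_hom] by blast
qed

text \<open>With the identity in the middle, the first two squares become the defining equations of
  \<theta> and \<nu>; only the square with \<delta>1 and \<delta>2 is additional.\<close>

lemma triangle_map_iff:
  "triangle_map C (\<epsilon>1, \<eta>1, \<delta>1) (\<epsilon>2, \<eta>2, \<delta>2) (\<theta>, Idn C (Unt C), \<nu>) \<longleftrightarrow>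
    \<theta> \<in> Hom C K1 K2 \<and> \<nu> \<in> Hom C U1 U2 \<and> \<epsilon>2 \<cdot> \<theta> = \<epsilon>1 \<and> \<nu> \<cdot> \<eta>1 = \<eta>2 \<and>
    \<theta>[1]\<^sub>m \<cdot> \<delta>1 = \<delta>2 \<cdot> \<nu>"
proof -
  have "Dom C \<epsilon>1 = K1" "Dom C \<epsilon>2 = K2" "Dom C \<eta>1 = Unt C" "Dom C \<eta>2 = Unt C"
    "Dom C \<delta>1 = U1" "Dom C \<delta>2 = U2"
    using L.eps_hom R.eps_hom L.eta_hom R.eta_hom L.delta_hom R.delta_hom by (auto simp: Hom_def)
  then show ?thesis
    using L.idn_hom[OF L.unt_obj] L.idn_comp[OF L.eps_hom] L.comp_idn[OF R.eta_hom] by auto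
qed

lemma triangle_map_ex:
  assumes \<theta>: "\<theta> \<in> Hom C K1 K2" "\<epsilon>2 \<cdot> \<theta> = \<epsilon>1"
  shows "\<exists>\<nu>. triangle_map C (\<epsilon>1, \<eta>1, \<delta>1) (\<epsilon>2, \<eta>2, \<delta>2) (\<theta>, Idn C (Unt C), \<nu>)"
proof -
  have "\<theta> \<in> Hom C (Dom C \<epsilon>1) (Dom C \<epsilon>2)" "Idn C (Unt C) \<in> Hom C (Cod C \<epsilon>1) (Cod C \<epsilon>2)"
    using \<theta>(1) L.eps_hom R.eps_hom L.idn_hom[OF L.unt_obj] by (auto simp: Hom_def)
  then show ?thesis
    using L.tri_fill[OF L.tri R.tri] L.idn_comp[OF L.eps_hom] \<theta>(2) by simp
qed

section \<open>Uniqueness, the map of triangles and relative idempotency\<close>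

context
  assumes zero: "\<eta>2 \<cdot> \<epsilon>1 = Zero C K1 U2"
begin

text \<open>The assumption makes K1 \<otimes> U2 zero, which is what cancelling \<eta>1 before
  arrows into U2 requires.\<close>

lemma factor_eta_unique:
  "\<nu> \<in> Hom C U1 U2 \<Longrightarrow> \<nu>' \<in> Hom C U1 U2 \<Longrightarrow> \<nu> \<cdot> \<eta>1 = \<eta>2 \<Longrightarrow> \<nu>' \<cdot> \<eta>1 = \<eta>2 \<Longrightarrow> \<nu> = \<nu>'"
  using L.eta_epi[of \<nu> U2 \<nu>'] zero K1_U2_zero_iff by simp

text \<open>Here U2 \<otimes> K1 is zero, so \<epsilon>2 can be cancelled after arrows out of
  K1.\<close>

lemma factor_eps_unique:
  "\<theta> \<in> Hom C K1 K2 \<Longrightarrow> \<theta>' \<in> Hom C K1 K2 \<Longrightarrow> \<epsilon>2 \<cdot> \<theta> = \<epsilon>1 \<Longrightarrow> \<epsilon>2 \<cdot> \<theta>' = \<epsilon>1 \<Longrightarrow> \<theta> = \<theta>'"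
  using R.eps_mono[of \<theta> K1 \<theta>'] zero U2_K1_zero_iff by simp

text \<open>The last square is not computed: \<theta> extends to some map of triangles, and
  uniqueness identifies its third component with \<nu>.\<close>

lemma factors_triangle_map:
  assumes \<nu>: "\<nu> \<in> Hom C U1 U2" "\<nu> \<cdot> \<eta>1 = \<eta>2" and \<theta>: "\<theta> \<in> Hom C K1 K2" "\<epsilon>2 \<cdot> \<theta> = \<epsilon>1"
  shows "triangle_map C (\<epsilon>1, \<eta>1, \<delta>1) (\<epsilon>2, \<eta>2, \<delta>2) (\<theta>, Idn C (Unt C), \<nu>)"
  using triangle_map_ex[OF \<theta>] factor_eta_unique[OF \<nu>(1) _ \<nu>(2)] triangle_map_iff by metis

text \<open>In (\<nu> \<otimes> U2) (\<eta>1 \<otimes> U2) = \<eta>2 \<otimes> U2 both \<eta>1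
  \<otimes> U2 and \<eta>2 \<otimes> U2 are invertible, because K1 \<otimes> U2 and K2 \<otimes> U2
  are zero; hence so is \<nu> \<otimes> U2. The other side is analogous.\<close>

lemma factor_eta_unital:
  assumes \<nu>: "\<nu> \<in> Hom C U1 U2" "\<nu> \<cdot> \<eta>1 = \<eta>2"
  shows "unital_idempotent_rel C U1 U2 \<nu>"
proof -
  note O = L.U_obj R.U_obj
  have "U1 \<otimes>\<^sub>o U1 \<simeq> U1"
    using L.U_tens_iff[OF O(1)] L.KU_zero by blast
  moreover have "iso_arr C (\<nu> \<otimes>\<^sub>m Idn C U2)"
  proof (rule L.iso_cancel_right)
    show "iso_arr C (\<eta>1 \<otimes>\<^sub>m Idn C U2)"
      using L.eta_tens_iso[OF O(2)] zero K1_U2_zero_iff by blast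
    show "iso_arr C ((\<nu> \<otimes>\<^sub>m Idn C U2) \<cdot> (\<eta>1 \<otimes>\<^sub>m Idn C U2))"
      using R.eta_tens_iso[OF O(2) R.KU_zero] L.comp_tens_idn[OF O(2) L.eta_hom \<nu>(1)] \<nu>(2) by simp
  qed (rule L.eta_tens_hom[OF O(2)] L.tens_idn_hom[OF O(2) \<nu>(1)])+
  moreover have "iso_arr C (Idn C U2 \<otimes>\<^sub>m \<nu>)"
  proof (rule L.iso_cancel_right)
    show "iso_arr C (Idn C U2 \<otimes>\<^sub>m \<eta>1)"
      using L.tens_eta_iso[OF O(2)] zero U2_K1_zero_iff by blast
    show "iso_arr C ((Idn C U2 \<otimes>\<^sub>m \<nu>) \<cdot> (Idn C U2 \<otimes>\<^sub>m \<eta>1))"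
      using R.tens_eta_iso[OF O(2) R.UK_zero] L.idn_tens_comp[OF O(2) L.eta_hom \<nu>(1)] \<nu>(2) by simp
  qed (rule L.tens_eta_hom[OF O(2)] L.idn_tens_hom[OF O(2) \<nu>(1)])+
  ultimately show ?thesis
    using O \<nu>(1) by (simp add: unital_idempotent_rel_def)
qed

text \<open>Dually, \<epsilon>2 \<otimes> K1 is cancelled on the left in (\<epsilon>2 \<otimes> K1)
  (\<theta> \<otimes> K1) = \<epsilon>1 \<otimes> K1.\<close>

lemma factor_eps_counital:
  assumes \<theta>: "\<theta> \<in> Hom C K1 K2" "\<epsilon>2 \<cdot> \<theta> = \<epsilon>1"
  shows "counital_idempotent_rel C K2 K1 \<theta>"
proof -
  note O = L.K_obj R.K_obj
  have "K2 \<otimes>\<^sub>o K2 \<simeq> K2"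
    using R.K_tens_iff[OF O(2)] R.UK_zero by blast
  moreover have "iso_arr C (\<theta> \<otimes>\<^sub>m Idn C K1)"
  proof (rule L.iso_cancel_left)
    show "iso_arr C (\<epsilon>2 \<otimes>\<^sub>m Idn C K1)"
      using R.eps_tens_iso[OF O(1)] zero U2_K1_zero_iff by blast
    show "iso_arr C ((\<epsilon>2 \<otimes>\<^sub>m Idn C K1) \<cdot> (\<theta> \<otimes>\<^sub>m Idn C K1))"
      using L.eps_tens_iso[OF O(1) L.UK_zero] L.comp_tens_idn[OF O(1) \<theta>(1) R.eps_hom] \<theta>(2) by simp
  qed (rule R.eps_tens_hom[OF O(1)] L.tens_idn_hom[OF O(1) \<theta>(1)])+
  moreover have "iso_arr C (Idn C K1 \<otimes>\<^sub>m \<theta>)"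
  proof (rule L.iso_cancel_left)
    show "iso_arr C (Idn C K1 \<otimes>\<^sub>m \<epsilon>2)"
      using R.tens_eps_iso[OF O(1)] zero K1_U2_zero_iff by blast
    show "iso_arr C ((Idn C K1 \<otimes>\<^sub>m \<epsilon>2) \<cdot> (Idn C K1 \<otimes>\<^sub>m \<theta>))"
      using L.tens_eps_iso[OF O(1) L.KU_zero] L.idn_tens_comp[OF O(1) \<theta>(1) R.eps_hom] \<theta>(2) by simp
  qed (rule R.tens_eps_hom[OF O(1)] L.idn_tens_hom[OF O(1) \<theta>(1)])+
  ultimately show ?thesis
    using O \<theta>(1) by (simp add: counital_idempotent_rel_def)
qed

text \<open>The pair \<open>p\<close> bundles \<theta> and \<nu> so that they are jointly unique.
  The first two squares already determine both; extending \<theta> gives existence.\<close>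

lemma triangle_map_unique:
  "\<exists>!p. triangle_map C (\<epsilon>1, \<eta>1, \<delta>1) (\<epsilon>2, \<eta>2, \<delta>2) (fst p, Idn C (Unt C), snd p)"
proof -
  obtain \<theta> where \<theta>: "\<theta> \<in> Hom C K1 K2" "\<epsilon>2 \<cdot> \<theta> = \<epsilon>1"
    using zero factor_eps_iff by blast
  obtain \<nu> where \<nu>: "triangle_map C (\<epsilon>1, \<eta>1, \<delta>1) (\<epsilon>2, \<eta>2, \<delta>2) (\<theta>, Idn C (Unt C), \<nu>)"
    using triangle_map_ex[OF \<theta>] by blast
  show ?thesis
  proof (rule ex1I[of _ "(\<theta>, \<nu>)"])
    show "triangle_map C (\<epsilon>1, \<eta>1, \<delta>1) (\<epsilon>2, \<eta>2, \<delta>2) (fst (\<theta>, \<nu>), Idn C (Unt C), snd (\<theta>, \<nu>))"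
      using \<nu> by simp
    fix p assume "triangle_map C (\<epsilon>1, \<eta>1, \<delta>1) (\<epsilon>2, \<eta>2, \<delta>2) (fst p, Idn C (Unt C), snd p)"
    then have "fst p = \<theta>" "snd p = \<nu>"
      using \<nu> factor_eps_unique factor_eta_unique unfolding triangle_map_iff by blast+
    then show "p = (\<theta>, \<nu>)"
      by (simp add: prod_eq_iff)
  qed
qed

end

end

section \<open>The six equivalent conditions and their consequences\<close>

theorem theorem4p24:
  fixes T :: "('o, 'm, 'z) tmcat_scheme" (structure)
    and C1 U1 C2 U2 :: 'o
    and \<epsilon>1 \<eta>1 \<delta>1 \<epsilon>2 \<eta>2 \<delta>2 :: 'm
  assumes "triangulated_monoidal_category T"
    and "complementary_idempotents T C1 U1 \<epsilon>1 \<eta>1 \<delta>1"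
    and "complementary_idempotents T C2 U2 \<epsilon>2 \<eta>2 \<delta>2"
  shows "let c1 = (U1 \<otimes>\<^sub>o U2 \<simeq> U2);
             c2 = (U2 \<otimes>\<^sub>o U1 \<simeq> U2);
             c3 = (\<exists>\<nu> \<in> Hom T U1 U2. \<nu> \<cdot> \<eta>1 = \<eta>2);
             c4 = (C1 \<otimes>\<^sub>o C2 \<simeq> C1);
             c5 = (C2 \<otimes>\<^sub>o C1 \<simeq> C1);
             c6 = (\<exists>\<theta> \<in> Hom T C1 C2. \<epsilon>2 \<cdot> \<theta> = \<epsilon>1)
         in (c1 \<longleftrightarrow> c2) \<and> (c2 \<longleftrightarrow> c3) \<and> (c3 \<longleftrightarrow> c4) \<and> (c4 \<longleftrightarrow> c5) \<and> (c5 \<longleftrightarrow> c6) \<and>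
            (c1 \<or> c2 \<or> c3 \<or> c4 \<or> c5 \<or> c6 \<longrightarrow>
              (\<exists>!\<nu>. \<nu> \<in> Hom T U1 U2 \<and> \<nu> \<cdot> \<eta>1 = \<eta>2) \<and>
              (\<exists>!\<theta>. \<theta> \<in> Hom T C1 C2 \<and> \<epsilon>2 \<cdot> \<theta> = \<epsilon>1) \<and>
              (\<exists>!p. triangle_map T (\<epsilon>1, \<eta>1, \<delta>1) (\<epsilon>2, \<eta>2, \<delta>2) (fst p, Idn T (Unt T), snd p)) \<and>
              (\<forall>\<nu> \<theta>. \<nu> \<in> Hom T U1 U2 \<and> \<nu> \<cdot> \<eta>1 = \<eta>2 \<and> \<theta> \<in> Hom T C1 C2 \<and> \<epsilon>2 \<cdot> \<theta> = \<epsilon>1 \<longrightarrow>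
                triangle_map T (\<epsilon>1, \<eta>1, \<delta>1) (\<epsilon>2, \<eta>2, \<delta>2) (\<theta>, Idn T (Unt T), \<nu>) \<and>
                unital_idempotent_rel T U1 U2 \<nu> \<and>
                counital_idempotent_rel T C2 C1 \<theta>))"
proof -
  interpret complementary_pairs T C1 U1 \<epsilon>1 \<eta>1 \<delta>1 C2 U2 \<epsilon>2 \<eta>2 \<delta>2
    using assms
    by (intro complementary_pairs.intro complementary_pair.intro complementary_pair_axioms.intro)
  \<comment> \<open>Each of the four isomorphism conditions becomes the vanishing of C1 \<otimes> U2
    or U2 \<otimes> C1, hence of \<open>\<eta>2 \<cdot> \<epsilon>1\<close>. The factorization
    conditions were put in this form by \<open>factor_eta_iff\<close> and
    \<open>factor_eps_iff\<close>, so all six reduce to one equation.\<close>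
  have c1: "U1 \<otimes>\<^sub>o U2 \<simeq> U2 \<longleftrightarrow> \<eta>2 \<cdot> \<epsilon>1 = Zero T C1 U2"
    using L.U_tens_iff[OF R.U_obj] K1_U2_zero_iff by simp
  have c2: "U2 \<otimes>\<^sub>o U1 \<simeq> U2 \<longleftrightarrow> \<eta>2 \<cdot> \<epsilon>1 = Zero T C1 U2"
    using L.tens_U_iff[OF R.U_obj] U2_K1_zero_iff by simp
  have c4: "C1 \<otimes>\<^sub>o C2 \<simeq> C1 \<longleftrightarrow> \<eta>2 \<cdot> \<epsilon>1 = Zero T C1 U2"
    using R.tens_K_iff[OF L.K_obj] K1_U2_zero_iff by simp
  have c5: "C2 \<otimes>\<^sub>o C1 \<simeq> C1 \<longleftrightarrow> \<eta>2 \<cdot> \<epsilon>1 = Zero T C1 U2"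
    using R.K_tens_iff[OF L.K_obj] U2_K1_zero_iff by simp
  have "(\<exists>!\<nu>. \<nu> \<in> Hom T U1 U2 \<and> \<nu> \<cdot> \<eta>1 = \<eta>2) \<and> (\<exists>!\<theta>. \<theta> \<in> Hom T C1 C2 \<and> \<epsilon>2 \<cdot> \<theta> = \<epsilon>1)"
    if zero: "\<eta>2 \<cdot> \<epsilon>1 = Zero T C1 U2"
    using zero factor_eta_iff factor_eps_iff factor_eta_unique[OF zero] factor_eps_unique[OF zero]
    by blast
  then show ?thesis
    unfolding Let_def c1 c2 c4 c5 factor_eta_iff factor_eps_iff
    using triangle_map_unique factors_triangle_map factor_eta_unital factor_eps_counital by blast
qed

end
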